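(* Let $\mathsf{X}$ be a (one- or two-sided) irreducible, strictly sofic shift of almost finite type (AFT). Then the past set cover $(E_P,\mathcal{L}_P)$ of $\mathsf{X}$ is reducible.
   Context: A (two-sided) shift space $\mathsf{X}$ over a finite alphabet $\mathcal{A}$ is a closed shift-invariant subset of $\mathcal{A}^{\mathbf{Z}}$. The corresponding one-sided shift space is $\mathsf{X}^+=\{x_0x_1x_2\dots : x\in\mathsf{X}\}$ with the shift map. In both cases $\mathcal{B}(\mathsf{X})$ is the language: the set of finite words (including the empty word) occurring in elements. A shift is irreducible if for all words $u,w$ in its language there is $v$ in its language with $uvw$ in the language. A shift is of finite type (an SFT) if it can be described by a finite set of forbidden words; a factor map is a continuous shift-commuting surjection between shift spaces; a shift is sofic if it is the image of an SFT under a factor map, equivalently if it is presented by a labelled graph with finitely many vertices and edges (the one-sided shift being presented via right-infinite paths); strictly sofic means sofic but not an SFT. A two-sided shift $\mathsf{X}$ is of almost finite type (AFT) if there is an irreducible SFT $\mathsf{Y}$ and a factor map $\pi:\mathsf{Y}\to\mathsf{X}$ that is one-to-one on a nonempty open set. For a strictly sofic shift this is known to be equivalent to the left Fischer cover (the minimal left-resolving labelled graph presenting the shift) being right-closing, and this is the meaning of AFT for one-sided strictly sofic shifts. Left-resolving: edges ending at a common vertex carry distinct labels. Right-closing: for some $D\ge0$, any two paths of length $D+1$ with the same initial vertex and the same label have the same first edge. For $w\in\mathcal{B}(\mathsf{X})$ put $P_f(w)=\{v\in\mathcal{B}(\mathsf{X}) : vw\in\mathcal{B}(\mathsf{X})\}$.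 The past set cover $(E_P,\mathcal{L}_P)$ of $\mathsf{X}$ is the labelled directed graph whose vertices are the sets $P_f(w)$, $w\in\mathcal{B}(\mathsf{X})$, with an edge labelled $a\in\mathcal{A}$ from $P_f(w)$ to $P_f(v)$ if and only if $P_f(av)=P_f(w)$ (in particular $av\in\mathcal{B}(\mathsf{X})$). A directed graph is irreducible if for every pair $(u,v)$ of vertices there is a path (possibly of length $0$) from $u$ to $v$; otherwise it is reducible. The past set cover is reducible if $E_P$ is. *)

theory Defs
  imports "HOL-Analysis.Analysis" "Graph_Theory.Digraph" "Graph_Theory.Arc_Walk"
begin

section \<open>Shift spaces\<close>

text \<open>
  Sequences are functions \<open>'i \<Rightarrow> 'a\<close>, where the index type \<open>'i\<close> is \<^typ>\<open>int\<close> for two-sided and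
  \<^typ>\<open>nat\<close> for one-sided shifts. Notions that read the same in both cases are defined once, for an
  arbitrary semiring \<open>'i\<close>. Alphabets are finite sets rather than types, so that one can quantify
  existentially over the alphabet of a cover.
\<close>

definition shift :: "('i::semiring_1 \<Rightarrow> 'a) \<Rightarrow> 'i \<Rightarrow> 'a" where
  "shift x = (\<lambda>i. x (i + 1))"

definition full_shift_topology :: "'a set \<Rightarrow> ('i \<Rightarrow> 'a) topology" where
  "full_shift_topology A = product_topology (\<lambda>_. discrete_topology A) UNIV"

definition two_sided_shift :: "'a set \<Rightarrow> (int \<Rightarrow> 'a) set \<Rightarrow> bool" where
  "two_sided_shift A X \<longleftrightarrow>
     finite A \<and> closedin (full_shift_topology A) X \<and> shift ` X = X"

definition one_sided_shift :: "'a set \<Rightarrow> (nat \<Rightarrow> 'a) set \<Rightarrow> bool" where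
  "one_sided_shift A X \<longleftrightarrow>
     (\<exists>Z. two_sided_shift A Z \<and> X = (\<lambda>x n. x (int n)) ` Z)"

definition occurs_in :: "'a list \<Rightarrow> ('i::semiring_1 \<Rightarrow> 'a) \<Rightarrow> bool" where
  "occurs_in w x \<longleftrightarrow> (\<exists>i. \<forall>k<length w. w ! k = x (i + of_nat k))"

definition language :: "('i::semiring_1 \<Rightarrow> 'a) set \<Rightarrow> 'a list set" where
  "language X = {w. \<exists>x\<in>X. occurs_in w x}"

definition irreducible_shift :: "('i::semiring_1 \<Rightarrow> 'a) set \<Rightarrow> bool" where
  "irreducible_shift X \<longleftrightarrow>
     (\<forall>u\<in>language X. \<forall>w\<in>language X. \<exists>v\<in>language X. u @ v @ w \<in> language X)"

definition finite_type :: "'a set \<Rightarrow> ('i::semiring_1 \<Rightarrow> 'a) set \<Rightarrow> bool" where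
  "finite_type A X \<longleftrightarrow>
     (\<exists>F. finite F \<and> F \<subseteq> lists A \<and> X = {x. range x \<subseteq> A \<and> (\<forall>w\<in>F. \<not> occurs_in w x)})"

definition factor_map ::
  "'b set \<Rightarrow> ('i::semiring_1 \<Rightarrow> 'b) set \<Rightarrow> 'a set \<Rightarrow> ('i \<Rightarrow> 'a) set \<Rightarrow> (('i \<Rightarrow> 'b) \<Rightarrow> 'i \<Rightarrow> 'a) \<Rightarrow> bool"
  where
  "factor_map B Y A X \<pi> \<longleftrightarrow>
     continuous_map (subtopology (full_shift_topology B) Y) (subtopology (full_shift_topology A) X) \<pi>
     \<and> \<pi> ` Y = X \<and> (\<forall>y\<in>Y. \<pi> (shift y) = shift (\<pi> y))"

text \<open>
  The alphabet \<open>B\<close> of a covering SFT may be any finite set; up to renaming of symbols it is a finite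
  set of natural numbers.
\<close>

definition two_sided_sofic :: "'a set \<Rightarrow> (int \<Rightarrow> 'a) set \<Rightarrow> bool" where
  "two_sided_sofic A X \<longleftrightarrow> two_sided_shift A X \<and>
     (\<exists>(B :: nat set) Y \<pi>. two_sided_shift B Y \<and> finite_type B Y \<and> factor_map B Y A X \<pi>)"

definition one_sided_sofic :: "'a set \<Rightarrow> (nat \<Rightarrow> 'a) set \<Rightarrow> bool" where
  "one_sided_sofic A X \<longleftrightarrow> one_sided_shift A X \<and>
     (\<exists>(B :: nat set) Y \<pi>. one_sided_shift B Y \<and> finite_type B Y \<and> factor_map B Y A X \<pi>)"

definition two_sided_strictly_sofic :: "'a set \<Rightarrow> (int \<Rightarrow> 'a) set \<Rightarrow> bool" where
  "two_sided_strictly_sofic A X \<longleftrightarrow> two_sided_sofic A X \<and> \<not> finite_type A X"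

definition one_sided_strictly_sofic :: "'a set \<Rightarrow> (nat \<Rightarrow> 'a) set \<Rightarrow> bool" where
  "one_sided_strictly_sofic A X \<longleftrightarrow> one_sided_sofic A X \<and> \<not> finite_type A X"


section \<open>Labelled graphs\<close>

text \<open>
  A labelled graph is a \<^typ>\<open>('v, 'e) pre_digraph\<close> \<open>G\<close> together with a labelling \<open>lab\<close> of its arcs.
\<close>

text \<open>
  Bi-infinite paths for \<open>'i = int\<close>, right-infinite paths for \<open>'i = nat\<close>.
\<close>

definition infinite_path :: "('v, 'e) pre_digraph \<Rightarrow> ('i::semiring_1 \<Rightarrow> 'e) \<Rightarrow> bool" where
  "infinite_path G p \<longleftrightarrow> range p \<subseteq> arcs G \<and> (\<forall>i. head G (p i) = tail G (p (i + 1)))"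

definition presents ::
  "('v, 'e) pre_digraph \<Rightarrow> ('e \<Rightarrow> 'a) \<Rightarrow> ('i::semiring_1 \<Rightarrow> 'a) set \<Rightarrow> bool" where
  "presents G lab X \<longleftrightarrow> fin_digraph G \<and> X = {lab \<circ> p |p. infinite_path G p}"

definition left_resolving :: "('v, 'e) pre_digraph \<Rightarrow> ('e \<Rightarrow> 'a) \<Rightarrow> bool" where
  "left_resolving G lab \<longleftrightarrow>
     (\<forall>e\<in>arcs G. \<forall>f\<in>arcs G. head G e = head G f \<and> lab e = lab f \<longrightarrow> e = f)"

definition right_closing :: "('v, 'e) pre_digraph \<Rightarrow> ('e \<Rightarrow> 'a) \<Rightarrow> bool" where
  "right_closing G lab \<longleftrightarrow>
     (\<exists>D::nat. \<forall>u v w p q.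
        pre_digraph.awalk G u p v \<and> pre_digraph.awalk G u q w \<and>
        length p = D + 1 \<and> length q = D + 1 \<and> map lab p = map lab q \<longrightarrow> hd p = hd q)"

text \<open>
  Minimality refers to the number of vertices. The graphs are finite, so vertices and arcs may be
  taken to be natural numbers.
\<close>

definition left_fischer_cover ::
  "(nat, nat) pre_digraph \<Rightarrow> (nat \<Rightarrow> 'a) \<Rightarrow> ('i::semiring_1 \<Rightarrow> 'a) set \<Rightarrow> bool" where
  "left_fischer_cover G lab X \<longleftrightarrow>
     presents G lab X \<and> left_resolving G lab \<and>
     (\<forall>(H :: (nat, nat) pre_digraph) lab'.
        presents H lab' X \<and> left_resolving H lab' \<longrightarrow> card (verts G) \<le> card (verts H))"


section \<open>Almost finite type\<close>

definition two_sided_AFT :: "'a set \<Rightarrow> (int \<Rightarrow> 'a) set \<Rightarrow> bool" where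
  "two_sided_AFT A X \<longleftrightarrow>
     (\<exists>(B :: nat set) Y \<pi> U.
        two_sided_shift B Y \<and> finite_type B Y \<and> irreducible_shift Y \<and> factor_map B Y A X \<pi> \<and>
        openin (subtopology (full_shift_topology B) Y) U \<and> U \<noteq> {} \<and> inj_on \<pi> U)"

text \<open>
  For one-sided strictly sofic shifts the term is defined through the left Fischer cover.
\<close>

definition one_sided_AFT :: "(nat \<Rightarrow> 'a) set \<Rightarrow> bool" where
  "one_sided_AFT X \<longleftrightarrow> (\<exists>G lab. left_fischer_cover G lab X \<and> right_closing G lab)"


section \<open>The past set cover\<close>

definition past_set :: "('i::semiring_1 \<Rightarrow> 'a) set \<Rightarrow> 'a list \<Rightarrow> 'a list set" where
  "past_set X w = {v \<in> language X. v @ w \<in> language X}"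

text \<open>
  The middle component of an arc is its label. The condition \<open>a # v \<in> language X\<close> is part of
  \<open>P\<^sub>f(av)\<close> being a vertex.
\<close>

definition past_set_cover ::
  "('i::semiring_1 \<Rightarrow> 'a) set \<Rightarrow> ('a list set, 'a list set \<times> 'a \<times> 'a list set) pre_digraph" where
  "past_set_cover X =
     \<lparr>verts = past_set X ` language X,
      arcs = {(past_set X w, a, past_set X v) |w a v.
                w \<in> language X \<and> v \<in> language X \<and> a # v \<in> language X \<and>
                past_set X (a # v) = past_set X w},
      tail = (\<lambda>(s, a, t). s),
      head = (\<lambda>(s, a, t). t)\<rparr>"

definition reducible_graph :: "('v, 'e) pre_digraph \<Rightarrow> bool" where
  "reducible_graph G \<longleftrightarrow> \<not> (\<forall>u\<in>verts G. \<forall>v\<in>verts G. u \<rightarrow>\<^sup>*\<^bsub>G\<^esub> v)"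

end

theory Submission
  imports Defs
begin

text \<open>
  If the past set cover is irreducible, then every word \<open>m\<close> of the language \<open>L\<close> extends to some
  \<open>u @ m\<close> whose past set is all of \<open>L\<close>, the past set of the empty word. The AFT property gives an
  irreducible labelled graph for \<open>L\<close> that closes in both directions with some delay \<open>D\<close>, so that
  the paths with a given long label are disjoint between their first and last \<open>D\<close> steps. Their
  number is at least some minimum \<open>d\<close>. Choose \<open>m\<close> attaining \<open>d\<close>, and \<open>u\<close> as above. A long
  word \<open>y\<close> may be followed by \<open>u @ m\<close>, so the middle of \<open>y\<close> passes through \<open>d\<close> fixed
  vertices. Every path labelled \<open>y\<close> can be prolonged backwards through \<open>u @ m\<close> and therefore passes
  through one of these \<open>d\<close> vertices. Hence words overlapping in a word of length \<open>2 * D\<close> can be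
  glued, and the shift is of finite type.
\<close>

section \<open>Runs in labelled transition systems\<close>

text \<open>Closing makes counting possible: two runs with one label that meet at a middle position
  agree at all of them, so the number of visited states is the same at every middle position, while
  a longer context can only lower it. Once the minimum \<open>d\<close> is reached, inclusions
  between such sets of states become equalities. The length \<open>2 * D\<close> is the smallest for
  which a word has a middle position, namely \<open>D\<close>.

  The closing graph has two sources. In the one-sided case it is a component of the given left
  Fischer cover. In the two-sided case it is the graph of windows of the covering SFT; injectivity
  is known only on an open set there, and strong connectedness spreads it to all of the graph, since
  every run can be led back to one chosen window. Afterwards only the language matters, which lets
  both cases share the counting argument.\<close>

type_synonym ('v, 'a) edges = "('v \<times> 'a \<times> 'v) set"

text \<open>Values of \<open>r\<close> beyond \<open>length w\<close> are irrelevant, and for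
  \<open>w = []\<close> nothing is asked of \<open>r 0\<close>, not even membership in
  \<open>states E\<close>. Hence \<open>run_words E\<close> always contains \<open>[]\<close>, and
  facts about states ask for a nonempty word.\<close>

definition run :: "('v, 'a) edges \<Rightarrow> 'a list \<Rightarrow> (nat \<Rightarrow> 'v) \<Rightarrow> bool" where
  "run E w r \<longleftrightarrow> (\<forall>i<length w. (r i, w ! i, r (Suc i)) \<in> E)"

definition run_words :: "('v, 'a) edges \<Rightarrow> 'a list set" where
  "run_words E = {w. \<exists>r. run E w r}"

definition states :: "('v, 'a) edges \<Rightarrow> 'v set" where
  "states E = {s. \<exists>a t. (s, a, t) \<in> E \<or> (t, a, s) \<in> E}"

definition connects :: "('v, 'a) edges \<Rightarrow> 'v \<Rightarrow> 'a list \<Rightarrow> 'v \<Rightarrow> bool" where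
  "connects E s w t \<longleftrightarrow> (\<exists>r. run E w r \<and> r 0 = s \<and> r (length w) = t)"

definition strongly_connected_edges :: "('v, 'a) edges \<Rightarrow> bool" where
  "strongly_connected_edges E \<longleftrightarrow> (\<forall>s\<in>states E. \<forall>t\<in>states E. \<exists>w. connects E s w t)"

text \<open>\<open>D\<close> counts the letters read beyond the first one. Edges are triples, so
  determining the first edge amounts to determining the second state.\<close>

definition right_closed :: "nat \<Rightarrow> ('v, 'a) edges \<Rightarrow> bool" where
  "right_closed D E \<longleftrightarrow> (\<forall>w r s. run E w r \<and> run E w s \<and> length w = Suc D \<and> r 0 = s 0
     \<longrightarrow> r 1 = s 1)"

definition left_closed :: "nat \<Rightarrow> ('v, 'a) edges \<Rightarrow> bool" where
  "left_closed D E \<longleftrightarrow> (\<forall>w r s. run E w r \<and> run E w s \<and> length w = Suc D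
     \<and> r (Suc D) = s (Suc D) \<longrightarrow> r D = s D)"

lemma run_append:
  assumes "run E u r" "run E v s" "r (length u) = s 0"
  shows "run E (u @ v) (\<lambda>i. if i \<le> length u then r i else s (i - length u))"
  unfolding run_def
proof (intro allI impI)
  fix i assume i: "i < length (u @ v)"
  consider "i < length u" | "i = length u" | "i > length u" by linarith
  then show "(if i \<le> length u then r i else s (i - length u), (u @ v) ! i,
      if Suc i \<le> length u then r (Suc i) else s (Suc i - length u)) \<in> E"
  proof cases
    case 1 then show ?thesis using assms by (auto simp: run_def nth_append)
  next
    case 2
    have "(s 0, v ! 0, s (Suc 0)) \<in> E" using 2 i assms(2) by (auto simp: run_def)
    with 2 show ?thesis using assms by (auto simp: nth_append)
  next
    case 3
    have "(s (i - length u), v ! (i - length u), s (Suc (i - length u))) \<in> E"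
      using 3 i assms(2) by (auto simp: run_def)
    with 3 show ?thesis by (auto simp: nth_append Suc_diff_le)
  qed
qed

lemma run_infix:
  assumes "run E (u @ v @ w) r"
  shows "run E v (\<lambda>i. r (length u + i))"
  unfolding run_def
proof (intro allI impI)
  fix i assume "i < length v"
  then have "(r (length u + i), (u @ v @ w) ! (length u + i), r (Suc (length u + i))) \<in> E"
    using assms unfolding run_def by (metis add_less_cancel_left length_append trans_less_add1)
  then show "(r (length u + i), v ! i, r (length u + Suc i)) \<in> E"
    using \<open>i < length v\<close> by (simp add: nth_append)
qed

lemma run_prefix: "run E (u @ v) r \<Longrightarrow> run E u r"
  using run_infix[of E "[]" u v r] by simp

lemma run_suffix: "run E (u @ v) r \<Longrightarrow> run E v (\<lambda>i. r (length u + i))"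
  using run_infix[of E u v "[]" r] by simp

lemma run_slice:
  assumes "run E w r" "i + n \<le> length w"
  shows "run E (take n (drop i w)) (\<lambda>k. r (i + k))"
  using assms by (auto simp: run_def)

lemma run_state:
  assumes "run E w r" "w \<noteq> []" "i \<le> length w"
  shows "r i \<in> states E"
proof (cases "i < length w")
  case True then show ?thesis using assms by (auto simp: run_def states_def)
next
  case False
  with assms have i: "i = Suc (length w - 1)" "length w - 1 < length w" by auto
  have "(r (length w - 1), w ! (length w - 1), r i) \<in> E"
    using assms(1) i unfolding run_def by metis
  then show ?thesis by (auto simp: states_def)
qed

lemma run_mono: "run E w r \<Longrightarrow> E \<subseteq> E' \<Longrightarrow> run E' w r"
  by (auto simp: run_def)

lemma run_words_infix: "u @ v @ w \<in> run_words E \<Longrightarrow> v \<in> run_words E"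
  unfolding run_words_def using run_infix by blast

lemma run_words_prefix: "u @ v \<in> run_words E \<Longrightarrow> u \<in> run_words E"
  using run_words_infix[of "[]" u v] by simp

lemma connects_Nil [simp]: "connects E s [] t \<longleftrightarrow> s = t"
  by (auto simp: connects_def run_def)

lemma connects_edge: "(s, a, t) \<in> E \<Longrightarrow> connects E s [a] t"
  unfolding connects_def run_def
  by (rule exI[of _ "\<lambda>i. if i = 0 then s else t"]) auto

lemma connects_append:
  assumes "connects E s u t" "connects E t v q"
  shows "connects E s (u @ v) q"
proof -
  obtain r where r: "run E u r" "r 0 = s" "r (length u) = t"
    using assms(1) by (auto simp: connects_def)
  obtain r' where r': "run E v r'" "r' 0 = t" "r' (length v) = q"
    using assms(2) by (auto simp: connects_def)
  show ?thesis unfolding connects_def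
    by (rule exI, intro conjI, rule run_append[OF r(1) r'(1)]) (use r r' in auto)
qed

lemma connects_slice:
  assumes "run E w r" "i \<le> j" "j \<le> length w"
  shows "connects E (r i) (take (j - i) (drop i w)) (r j)"
  unfolding connects_def
  using run_slice[OF assms(1), of i "j - i"] assms
  by (intro exI[of _ "\<lambda>k. r (i + k)"]) auto

lemma finite_states: "finite E \<Longrightarrow> finite (states E)"
proof -
  assume "finite E"
  moreover have "states E \<subseteq> fst ` E \<union> (\<lambda>(s, a, t). t) ` E"
    by (force simp: states_def)
  ultimately show ?thesis by (meson finite_UnI finite_imageI finite_subset)
qed

lemma right_closed_mono:
  assumes "right_closed D E" "D \<le> D'"
  shows "right_closed D' E"
  unfolding right_closed_def
proof (intro allI impI, elim conjE)
  fix w r s assume *: "run E w r" "run E w s" "length w = Suc D'" "r 0 = s 0"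
  have "run E (take (Suc D) w) r" "run E (take (Suc D) w) s"
    using * assms(2) by (auto simp: run_def)
  moreover have "length (take (Suc D) w) = Suc D" using * assms(2) by simp
  ultimately show "r 1 = s 1" using assms(1) *(4) unfolding right_closed_def by blast
qed

lemma left_closed_mono:
  assumes "left_closed D E" "D \<le> D'"
  shows "left_closed D' E"
  unfolding left_closed_def
proof (intro allI impI, elim conjE)
  fix w r s assume *: "run E w r" "run E w s" "length w = Suc D'" "r (Suc D') = s (Suc D')"
  let ?k = "D' - D"
  have "run E (take (Suc D) (drop ?k w)) (\<lambda>i. r (?k + i))" 
    "run E (take (Suc D) (drop ?k w)) (\<lambda>i. s (?k + i))"
    using * assms(2) by (intro run_slice; linarith)+
  moreover have "length (take (Suc D) (drop ?k w)) = Suc D" using * assms(2) by simp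
  moreover have "r (?k + Suc D) = s (?k + Suc D)" using * assms(2) by simp
  ultimately have "r (?k + D) = s (?k + D)" using assms(1) unfolding left_closed_def by blast
  then show "r D' = s D'" using assms(2) by simp
qed

lemma right_closed_subset: "right_closed D E \<Longrightarrow> E' \<subseteq> E \<Longrightarrow> right_closed D E'"
  unfolding right_closed_def using run_mono by metis

lemma left_closed_subset: "left_closed D E \<Longrightarrow> E' \<subseteq> E \<Longrightarrow> left_closed D E'"
  unfolding left_closed_def using run_mono by metis


section \<open>Bi-closing transition systems\<close>

text \<open>\<open>D > 0\<close> makes words of length \<open>2 * D\<close> nonempty, so that their
  sets of visited states are finite. It can always be arranged, because closing with delay
  \<open>D\<close> implies closing with any larger delay.\<close>

locale biclosing =
  fixes E :: "('v, 'a) edges" and D :: nat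
  assumes fin: "finite E" and connected: "strongly_connected_edges E"
    and right: "right_closed D E" and left: "left_closed D E" and D_pos: "D > 0"
begin

definition visited :: "'a list \<Rightarrow> nat \<Rightarrow> 'v set" where
  "visited w i = {r i |r. run E w r}"

text \<open>Runs over the longer word restrict to runs over \<open>v\<close>, but not every run over
  \<open>v\<close> need extend: more context means fewer states.\<close>

lemma visited_infix: "visited (u @ v @ w) (length u + i) \<subseteq> visited v i"
  unfolding visited_def by (auto dest: run_infix)

lemma finite_visited: "w \<noteq> [] \<Longrightarrow> i \<le> length w \<Longrightarrow> finite (visited w i)"
  by (rule finite_subset[OF _ finite_states[OF fin]]) (auto simp: visited_def run_state)

text \<open>Agreement spreads one step at a time, and each step looks at a window of
  \<open>Suc D\<close> letters. It therefore reaches \<open>j\<close> only if \<open>D\<close>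
  letters follow.\<close>

lemma run_eq_right:
  assumes "run E w r" "run E w s" "r i = s i" "i \<le> j" "j + D \<le> length w"
  shows "r j = s j"
  using assms(4,5)
proof (induction j rule: dec_induct)
  case base then show ?case using assms(3) by simp
next
  case (step j)
  then have *: "r (j + 0) = s (j + 0)" by simp
  have "run E (take (Suc D) (drop j w)) (\<lambda>k. r (j + k))"
    "run E (take (Suc D) (drop j w)) (\<lambda>k. s (j + k))"
    using assms step.prems by (auto intro!: run_slice)
  moreover have "length (take (Suc D) (drop j w)) = Suc D" using step.prems by simp
  ultimately have "r (j + 1) = s (j + 1)"
    using right * unfolding right_closed_def by blast
  then show ?case by simp
qed

lemma run_eq_left:
  assumes "run E w r" "run E w s" "r j = s j" "D \<le> i" "i \<le> j" "j \<le> length w"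
  shows "r i = s i"
  using assms(5,4)
proof (induction i rule: inc_induct)
  case base then show ?case using assms(3) by simp
next
  case (step i)
  let ?k = "i - D"
  have "run E (take (Suc D) (drop ?k w)) (\<lambda>n. r (?k + n))"
    "run E (take (Suc D) (drop ?k w)) (\<lambda>n. s (?k + n))"
    using assms step by (intro run_slice; linarith)+
  moreover have "length (take (Suc D) (drop ?k w)) = Suc D" using step assms by simp
  moreover have "r (?k + Suc D) = s (?k + Suc D)" using step by simp
  ultimately have "r (?k + D) = s (?k + D)" using left unfolding left_closed_def by blast
  then show ?case using step by simp
qed

text \<open>By the two closing conditions, runs agree at \<open>i\<close> iff they agree at
  \<open>j\<close>. So sending the state of a run at \<open>i\<close> to its state at
  \<open>j\<close> is a well-defined bijection, whichever run the choice in \<open>f\<close>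
  picks.\<close>

lemma card_visited_eq:
  assumes "D \<le> i" "i \<le> j" "j + D \<le> length w"
  shows "card (visited w i) = card (visited w j)"
proof -
  have eq: "r i = s i \<longleftrightarrow> r j = s j" if "run E w r" "run E w s" for r s
    using run_eq_right[OF that, of i j] run_eq_left[OF that, of j i] assms by auto
  define f where "f q = (SOME r. run E w r \<and> r i = q) j" for q
  have f: "f (r i) = r j" if "run E w r" for r
  proof -
    have "run E w (SOME s. run E w s \<and> s i = r i) \<and> (SOME s. run E w s \<and> s i = r i) i = r i"
      by (rule someI[where x = r]) (use that in simp)
    then show ?thesis unfolding f_def using eq[OF _ that] by blast
  qed
  have "inj_on f (visited w i)"
  proof (rule inj_onI)
    fix p q assume "p \<in> visited w i" "q \<in> visited w i" "f p = f q"
    then obtain r s where "p = r i" "run E w r" "q = s i" "run E w s" by (auto simp: visited_def)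
    then show "p = q" using eq[of r s] f[of r] f[of s] \<open>f p = f q\<close> by metis
  qed
  moreover have "f ` visited w i = visited w j"
  proof (intro subset_antisym subsetI)
    fix q assume "q \<in> f ` visited w i"
    then show "q \<in> visited w j" using f by (auto simp: visited_def)
  next
    fix q assume "q \<in> visited w j"
    then obtain r where "q = r j" "run E w r" by (auto simp: visited_def)
    then have "r i \<in> visited w i" "q = f (r i)" using f by (auto simp: visited_def)
    then show "q \<in> f ` visited w i" by blast
  qed
  ultimately show ?thesis by (metis card_image)
qed

theorem glue_words:
  assumes magic: "\<And>m. m \<in> run_words E \<Longrightarrow>
      \<exists>u. u @ m \<in> run_words E \<and> (\<forall>w\<in>run_words E. w @ u @ m \<in> run_words E)"
    and xy: "x @ y \<in> run_words E" and yz: "y @ z \<in> run_words E" and len: "length y = 2 * D"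
  shows "x @ y @ z \<in> run_words E"
proof -
  let ?L = "run_words E"
  define P where "P n \<longleftrightarrow> (\<exists>w\<in>?L. 2 * D \<le> length w \<and> card (visited w D) = n)" for n
  define d where "d = (LEAST n. P n)"
  have y: "y \<in> ?L" using yz run_words_prefix by blast
  then have "P (card (visited y D))" unfolding P_def using len by (intro bexI[of _ y]) auto
  then have "P d" unfolding d_def by (rule LeastI)
  then obtain m where m: "m \<in> ?L" "2 * D \<le> length m" "card (visited m D) = d"
    unfolding P_def by blast
  have d_le: "d \<le> card (visited w D)" if "w \<in> ?L" "2 * D \<le> length w" for w
    unfolding d_def by (rule Least_le) (use that P_def in blast)
  \<comment> \<open>At position \<open>D\<close> of the copy of \<open>m\<close> the count is at
    most that of \<open>m\<close> alone, hence equal to \<open>d\<close> by minimality; closing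
    carries it to every middle position of the whole word.\<close>
  have card_d: "card (visited (a @ m @ b) i) = d"
    if "a @ m @ b \<in> ?L" "D \<le> i" "i + D \<le> length (a @ m @ b)" for a b i
  proof -
    let ?w = "a @ m @ b"
    have "card (visited ?w i) = card (visited ?w D)"
      using card_visited_eq[of D i ?w] that by simp
    moreover have "card (visited ?w D) = card (visited ?w (length a + D))"
      using card_visited_eq[of D "length a + D" ?w] m that by simp
    moreover have "card (visited ?w (length a + D)) \<le> card (visited m D)"
      using m D_pos by (intro card_mono visited_infix finite_visited) auto
    moreover have "d \<le> card (visited ?w D)"
      using that m by (intro d_le) auto
    ultimately show ?thesis using m by linarith
  qed
  obtain u where u: "u @ m \<in> ?L" "\<And>w. w \<in> ?L \<Longrightarrow> w @ u @ m \<in> ?L"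
    using magic[OF m(1)] by blast
  have y_ne: "y \<noteq> []" using len D_pos by auto
  define T where "T = visited (y @ u @ m) D"
  have T: "card T = d" "finite T"
    unfolding T_def using card_d[of "y @ u" "[]" D] u(2)[OF y] m len D_pos
    by (auto intro!: finite_visited)
  \<comment> \<open>Both words contain \<open>m\<close>, so both sets have \<open>d\<close> elements
    and the left context \<open>a\<close> removes no state from \<open>T\<close>.\<close>
  have context_free: "visited (a @ y @ u @ m) (length a + D) = T" if "a @ y \<in> ?L" for a
  proof (rule card_subset_eq[OF T(2)])
    show "visited (a @ y @ u @ m) (length a + D) \<subseteq> T"
      unfolding T_def using visited_infix[of a "y @ u @ m" "[]" D] by simp
    show "card (visited (a @ y @ u @ m) (length a + D)) = card T"
      using card_d[of "a @ y @ u" "[]" "length a + D"] u(2)[OF that] m len T by simp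
  qed
  have visited_T: "visited y D \<subseteq> T"
  proof
    fix p assume "p \<in> visited y D"
    then obtain r where r: "run E y r" "p = r D" by (auto simp: visited_def)
    \<comment> \<open>A run over \<open>u @ m\<close> is led by some \<open>e\<close> to the start
      of \<open>r\<close>. The resulting word already contains \<open>m\<close> to the left of
      \<open>y\<close>, so its count is \<open>d\<close> and appending \<open>u @ m\<close> on the
      right cannot remove \<open>p\<close>.\<close>
    obtain \<rho> where \<rho>: "run E (u @ m) \<rho>" using u(1) by (auto simp: run_words_def)
    have "\<rho> (length (u @ m)) \<in> states E"
      by (rule run_state[OF \<rho>]) (use m D_pos in auto)
    moreover have "r 0 \<in> states E" by (rule run_state[OF r(1)]) (use y_ne in auto)
    ultimately obtain e where "connects E (\<rho> (length (u @ m))) e (r 0)"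
      using connected unfolding strongly_connected_edges_def by blast
    then obtain \<tau> where \<tau>: "run E e \<tau>" "\<tau> 0 = \<rho> (length (u @ m))" "\<tau> (length e) = r 0"
      by (auto simp: connects_def)
    define \<sigma> where "\<sigma> = (\<lambda>i. if i \<le> length (u @ m) then \<rho> i else \<tau> (i - length (u @ m)))"
    have \<sigma>: "run E ((u @ m) @ e) \<sigma>" "\<sigma> (length ((u @ m) @ e)) = r 0"
      unfolding \<sigma>_def using run_append[OF \<rho> \<tau>(1)] \<tau> by auto
    let ?a = "(u @ m) @ e"
    define \<pi> where "\<pi> = (\<lambda>i. if i \<le> length ?a then \<sigma> i else r (i - length ?a))"
    have \<pi>: "run E (?a @ y) \<pi>" "\<pi> (length ?a + D) = p"
      unfolding \<pi>_def using run_append[OF \<sigma>(1) r(1) \<sigma>(2)] r D_pos by auto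
    then have p: "p \<in> visited (?a @ y) (length ?a + D)" and ay: "?a @ y \<in> ?L"
      by (auto simp: visited_def run_words_def)
    have "visited (?a @ y @ u @ m) (length ?a + D) = visited (?a @ y) (length ?a + D)"
    proof (rule card_subset_eq)
      show "finite (visited (?a @ y) (length ?a + D))"
        using len y_ne by (intro finite_visited) auto
      show "visited (?a @ y @ u @ m) (length ?a + D) \<subseteq> visited (?a @ y) (length ?a + D)"
        using visited_infix[of "[]" "?a @ y" "u @ m" "length ?a + D"] by simp
      have "card (visited (?a @ y) (length ?a + D)) = d"
        using card_d[of u "e @ y" "length ?a + D"] ay len by simp
      then show "card (visited (?a @ y @ u @ m) (length ?a + D))
          = card (visited (?a @ y) (length ?a + D))"
        using context_free[OF ay] T by simp
    qed
    then show "p \<in> T" using p context_free[OF ay] by simp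
  qed
  obtain r where r: "run E (y @ z) r" using yz by (auto simp: run_words_def)
  have "r D \<in> visited y D" using run_prefix[OF r] by (auto simp: visited_def)
  \<comment> \<open>The run \<open>r\<close> knows the right context \<open>z\<close>, the run
    \<open>s\<close> found next knows the left context \<open>x\<close>. They meet at position
    \<open>D\<close> of \<open>y\<close>, where the glued run switches from \<open>s\<close> to
    \<open>r\<close>.\<close>
  then have "r D \<in> visited (x @ y @ u @ m) (length x + D)"
    using visited_T context_free[OF xy] by blast
  then obtain s where s: "run E (x @ y @ u @ m) s" "s (length x + D) = r D"
    by (auto simp: visited_def)
  have "x @ y @ u @ m = (x @ take D y) @ drop D y @ u @ m"
    by (simp flip: append_assoc) simp
  then have s': "run E (x @ take D y) s" using s(1) run_prefix by metis
  have "y @ z = take D y @ drop D y @ z" by (simp flip: append_assoc)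
  then have "run E (drop D y @ z) (\<lambda>i. r (length (take D y) + i))" using r run_suffix by metis
  then have "run E ((x @ take D y) @ drop D y @ z)
      (\<lambda>i. if i \<le> length (x @ take D y) then s i
        else r (length (take D y) + (i - length (x @ take D y))))"
    using s' s(2) len by (intro run_append) auto
  moreover have "(x @ take D y) @ drop D y @ z = x @ y @ z"
    by (simp flip: append_assoc) simp
  ultimately have "\<exists>\<sigma>. run E (x @ y @ z) \<sigma>" by metis
  then show ?thesis by (simp add: run_words_def)
qed

end


section \<open>Languages and the full shift\<close>

definition block :: "('i::semiring_1 \<Rightarrow> 'a) \<Rightarrow> 'i \<Rightarrow> nat \<Rightarrow> 'a list" where
  "block x i n = map (\<lambda>k. x (i + of_nat k)) [0..<n]"

lemma length_block [simp]: "length (block x i n) = n"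
  by (simp add: block_def)

lemma nth_block [simp]: "k < n \<Longrightarrow> block x i n ! k = x (i + of_nat k)"
  by (simp add: block_def)

lemma block_add: "block x i (m + n) = block x i m @ block x (i + of_nat m) n"
  by (rule nth_equalityI) (auto simp: nth_append add.assoc simp flip: of_nat_add)

lemma occurs_in_iff_block: "occurs_in w x \<longleftrightarrow> (\<exists>i. w = block x i (length w))"
  by (auto simp: occurs_in_def list_eq_iff_nth_eq)

lemma occurs_in_block [simp, intro]: "occurs_in (block x i n) x"
  by (auto simp: occurs_in_iff_block)

lemma language_infix:
  assumes "u @ v @ w \<in> language X"
  shows "v \<in> language X"
proof -
  obtain x i where x: "x \<in> X" "u @ v @ w = block x i (length u + (length v + length w))"
    using assms by (auto simp: language_def occurs_in_iff_block)
  then have "v = block x (i + of_nat (length u)) (length v)"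
    by (simp add: block_add)
  then show ?thesis using x by (auto simp: language_def occurs_in_iff_block)
qed

lemma language_prefix: "u @ v \<in> language X \<Longrightarrow> u \<in> language X"
  using language_infix[of "[]" u v] by simp

section \<open>Paths in the past set cover\<close>

lemma past_set_Nil: "past_set X [] = language X"
  by (simp add: past_set_def)

text \<open>An edge labelled \<open>a\<close> goes from the vertex of \<open>a # v\<close> to that
  of \<open>v\<close>. Walking a path backwards from the vertex of \<open>m\<close> therefore puts
  its labels in front of \<open>m\<close>.\<close>

lemma past_set_cover_reachable:
  assumes "S \<rightarrow>\<^sup>*\<^bsub>past_set_cover X\<^esub> past_set X m" "m \<in> language X"
  shows "\<exists>u. u @ m \<in> language X \<and> S = past_set X (u @ m)"
proof -
  have "(S, past_set X m) \<in> rtrancl_on (verts (past_set_cover X)) (arcs_ends (past_set_cover X))"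
    using assms(1) by (simp add: reachable_def)
  then show ?thesis
  proof (induction rule: converse_rtrancl_on_induct)
    case base
    then show ?case using assms(2) by (intro exI[of _ "[]"]) simp
  next
    case (step S S')
    obtain u where u: "u @ m \<in> language X" "S' = past_set X (u @ m)"
      using step.IH by blast
    obtain w a v where *: "S = past_set X w" "S' = past_set X v" "v \<in> language X"
      "a # v \<in> language X" "past_set X (a # v) = past_set X w"
      using step.hyps(1) by (auto simp: arcs_ends_def arc_to_ends_def past_set_cover_def)
    \<comment> \<open>\<open>v\<close> is merely some word with the past set of
      \<open>u @ m\<close>. It may be exchanged for \<open>u @ m\<close>, since the past set of
      \<open>a # t\<close> depends only on that of \<open>t\<close>: \<open>z\<close> can precede
      \<open>a # t\<close> iff \<open>z @ [a]\<close> can precede \<open>t\<close>.\<close>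
    have eq: "past_set X v = past_set X (u @ m)" using * u by simp
    have "[a] \<in> past_set X v"
      using *(4) language_prefix[of "[a]" v X] by (simp add: past_set_def)
    then have au: "(a # u) @ m \<in> language X" unfolding eq by (simp add: past_set_def)
    have "past_set X (a # v) = past_set X (a # u @ m)"
    proof (rule set_eqI)
      have shift: "z \<in> past_set X (a # t) \<longleftrightarrow> z @ [a] \<in> past_set X t" for z t
      proof
        assume "z \<in> past_set X (a # t)"
        then show "z @ [a] \<in> past_set X t"
          using language_prefix[of "z @ [a]" t X] by (simp add: past_set_def)
      next
        assume "z @ [a] \<in> past_set X t"
        then show "z \<in> past_set X (a # t)"
          using language_prefix[of z "[a]" X] by (simp add: past_set_def)
      qed
      show "z \<in> past_set X (a # v) \<longleftrightarrow> z \<in> past_set X (a # u @ m)" for z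
        unfolding shift eq ..
    qed
    then show ?case using au * by (intro exI[of _ "a # u"]) simp
  qed
qed

lemma irreducible_past_set_cover_prolong:
  assumes "\<not> reducible_graph (past_set_cover X)" "m \<in> language X"
  shows "\<exists>u. u @ m \<in> language X \<and> (\<forall>w\<in>language X. w @ u @ m \<in> language X)"
proof -
  have "[] \<in> language X" using assms(2) language_prefix[of "[]" m] by simp
  then have "past_set X [] \<rightarrow>\<^sup>*\<^bsub>past_set_cover X\<^esub> past_set X m"
    using assms unfolding reducible_graph_def by (auto simp: past_set_cover_def)
  then obtain u where u: "u @ m \<in> language X" "past_set X [] = past_set X (u @ m)"
    using past_set_cover_reachable assms(2) by blast
  have "w @ u @ m \<in> language X" if "w \<in> language X" for w
  proof -
    have "w \<in> past_set X (u @ m)" using that u(2) past_set_Nil by metis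
    then show ?thesis by (simp add: past_set_def)
  qed
  then show ?thesis using u(1) by blast
qed

text \<open>It is enough to forbid the words of length \<open>Suc n\<close> outside the language:
  longer blocks are assembled by attaching one letter at a time on the left, with an overlap of
  \<open>n\<close> letters. Assumption \<open>closed\<close> says that \<open>X\<close> is
  determined by its language.\<close>

lemma finite_type_if_glue:
  fixes X :: "('i::semiring_1 \<Rightarrow> 'a) set"
  assumes "finite A" and range: "\<And>x. x \<in> X \<Longrightarrow> range x \<subseteq> A"
    and closed: "\<And>x. range x \<subseteq> A \<Longrightarrow> (\<And>i n. block x i n \<in> language X) \<Longrightarrow> x \<in> X"
    and glue: "\<And>x y z. x @ y \<in> language X \<Longrightarrow> y @ z \<in> language X \<Longrightarrow> length y = n
      \<Longrightarrow> x @ y @ z \<in> language X"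
  shows "finite_type A X"
proof -
  define F where "F = {w \<in> lists A. length w = Suc n \<and> w \<notin> language X}"
  have "finite F"
    by (rule finite_subset[OF _ finite_lists_length_eq[OF \<open>finite A\<close>, of "Suc n"]])
      (auto simp: F_def)
  moreover have "X = {x. range x \<subseteq> A \<and> (\<forall>w\<in>F. \<not> occurs_in w x)}"
  proof (intro subset_antisym subsetI)
    fix x assume "x \<in> X"
    then show "x \<in> {x. range x \<subseteq> A \<and> (\<forall>w\<in>F. \<not> occurs_in w x)}"
      using range by (auto simp: F_def language_def)
  next
    fix x :: "'i \<Rightarrow> 'a"
    assume "x \<in> {x. range x \<subseteq> A \<and> (\<forall>w\<in>F. \<not> occurs_in w x)}"
    then have x: "range x \<subseteq> A" "\<And>w. occurs_in w x \<Longrightarrow> w \<notin> F" by auto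
    have long: "block x i (Suc n) \<in> language X" for i
    proof -
      have "block x i (Suc n) \<in> lists A" using subsetD[OF x(1) rangeI] by (auto simp: block_def)
      then show ?thesis using x(2)[OF occurs_in_block, of i "Suc n"] by (auto simp: F_def)
    qed
    have "block x i (m + Suc n) \<in> language X" for i m
    proof (induction m arbitrary: i)
      case 0 show ?case using long by simp
    next
      case (Suc m)
      have 1: "block x i 1 @ block x (i + 1) n \<in> language X"
        using long[of i] block_add[of x i 1 n] by simp
      have 2: "block x (i + 1) n @ block x (i + 1 + of_nat n) (Suc m) \<in> language X"
        using Suc[of "i + 1"] block_add[of x "i + 1" n "Suc m"] by (simp add: add.commute)
      show ?case
        using glue[OF 1 2] block_add[of x i 1 "n + Suc m"] block_add[of x "i + 1" n "Suc m"]
        by (simp add: ac_simps)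
    qed
    then have "block x i m \<in> language X" for i m
      using language_prefix[of "block x i m" "block x (i + of_nat m) (Suc n)" X]
      by (simp flip: block_add)
    then show "x \<in> X" using closed x(1) by blast
  qed
  moreover have "F \<subseteq> lists A" by (auto simp: F_def)
  ultimately show ?thesis unfolding finite_type_def by blast
qed

section \<open>Topology of the full shift\<close>

lemma topspace_full_shift: "topspace (full_shift_topology A) = {x. range x \<subseteq> A}"
  by (auto simp: full_shift_topology_def PiE_UNIV_domain)

lemma openin_full_shift_cylinder:
  assumes "openin (full_shift_topology A) S" "x \<in> S"
  shows "\<exists>J. finite J \<and> (\<forall>y. range y \<subseteq> A \<and> (\<forall>j\<in>J. y j = x j) \<longrightarrow> y \<in> S)"
proof -
  obtain U where U: "finite {i. U i \<noteq> A}" "x \<in> Pi\<^sub>E UNIV U" "Pi\<^sub>E UNIV U \<subseteq> S"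
    using assms unfolding full_shift_topology_def openin_product_topology_alt by simp blast
  have "y \<in> S" if "range y \<subseteq> A" "\<forall>j\<in>{i. U i \<noteq> A}. y j = x j" for y
  proof -
    have "y i \<in> U i" for i using that U(2) by (cases "U i = A") (auto simp: PiE_UNIV_domain)
    then show ?thesis using U(3) by (auto simp: PiE_UNIV_domain)
  qed
  then show ?thesis using U(1) by blast
qed

lemma cylinder_openin_full_shift:
  assumes "finite J" "range x \<subseteq> A"
  shows "openin (full_shift_topology A) {y. range y \<subseteq> A \<and> (\<forall>j\<in>J. y j = x j)}"
proof -
  define S where "S j = (if j \<in> J then {x j} else A)" for j
  have "{y. range y \<subseteq> A \<and> (\<forall>j\<in>J. y j = x j)} = Pi\<^sub>E UNIV S"
  proof (intro set_eqI iffI)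
    fix y assume "y \<in> {y. range y \<subseteq> A \<and> (\<forall>j\<in>J. y j = x j)}"
    then show "y \<in> Pi\<^sub>E UNIV S" by (auto simp: S_def)
  next
    fix y assume "y \<in> Pi\<^sub>E UNIV S"
    then have *: "y j \<in> S j" for j by (rule PiE_mem) simp
    have "y j \<in> A" for j using *[of j] assms(2) by (auto simp: S_def split: if_splits)
    moreover have "y j = x j" if "j \<in> J" for j using *[of j] that by (simp add: S_def)
    ultimately show "y \<in> {y. range y \<subseteq> A \<and> (\<forall>j\<in>J. y j = x j)}" by blast
  qed
  moreover have "openin (full_shift_topology A) (Pi\<^sub>E UNIV S)"
    unfolding full_shift_topology_def openin_PiE_gen
    using assms by (auto simp: S_def intro: finite_subset[OF _ assms(1)])
  ultimately show ?thesis by simp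
qed

lemma closedin_full_shift_approx:
  assumes "closedin (full_shift_topology A) X" "range x \<subseteq> A"
    and approx: "\<And>J. finite J \<Longrightarrow> \<exists>y\<in>X. \<forall>j\<in>J. y j = x j"
  shows "x \<in> X"
proof (rule ccontr)
  assume "x \<notin> X"
  then have *: "openin (full_shift_topology A) ({x. range x \<subseteq> A} - X)"
    "x \<in> {x. range x \<subseteq> A} - X"
    using assms by (auto simp: closedin_def topspace_full_shift)
  obtain J where "finite J"
    "\<forall>y. range y \<subseteq> A \<and> (\<forall>j\<in>J. y j = x j) \<longrightarrow> y \<in> {x. range x \<subseteq> A} - X"
    using openin_full_shift_cylinder[OF *] by blast
  moreover obtain y where "y \<in> X" "\<forall>j\<in>J. y j = x j" using approx \<open>finite J\<close> by blast
  moreover have "range y \<subseteq> A"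
    using \<open>y \<in> X\<close> closedin_subset[OF assms(1)] by (auto simp: topspace_full_shift)
  ultimately show False by blast
qed

lemma compactin_full_shift:
  assumes "finite A" "closedin (full_shift_topology A) X"
  shows "compactin (full_shift_topology A) X"
proof -
  have "compact_space (full_shift_topology A)"
    unfolding full_shift_topology_def using assms(1)
    by (simp add: compact_space_product_topology compact_space_discrete_topology)
  then show ?thesis using assms(2) closedin_compact_space by blast
qed

section \<open>Shift spaces are determined by their languages\<close>

lemma translate_closed:
  fixes x :: "int \<Rightarrow> 'a"
  assumes "shift ` X = X" "x \<in> X"
  shows "(\<lambda>i. x (i + n)) \<in> X"
  using assms(2)
proof (induction n arbitrary: x rule: int_induct[of _ 0])
  case base then show ?case by simp
next
  case (step1 n)
  have "shift x \<in> X" using assms(1) step1.prems by blast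
  from step1.IH[OF this] show ?case by (simp add: shift_def ac_simps)
next
  case (step2 n)
  then obtain z where "x = shift z" "z \<in> X" using assms(1) by blast
  with step2.IH[of z] show ?case by (simp add: shift_def)
qed

lemma two_sided_shift_range: "two_sided_shift A X \<Longrightarrow> x \<in> X \<Longrightarrow> range x \<subseteq> A"
  using closedin_subset[of "full_shift_topology A" X]
  by (auto simp: two_sided_shift_def topspace_full_shift)

lemma two_sided_shiftI_language:
  fixes x :: "int \<Rightarrow> 'a"
  assumes "two_sided_shift A X" "range x \<subseteq> A" "\<And>i n. block x i n \<in> language X"
  shows "x \<in> X"
proof (rule closedin_full_shift_approx)
  show "closedin (full_shift_topology A) X" using assms(1) by (simp add: two_sided_shift_def)
  show "range x \<subseteq> A" by fact
  fix J :: "int set" assume "finite J"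
  then obtain l where l: "\<And>j. j \<in> J \<Longrightarrow> \<bar>j\<bar> \<le> l"
    by (metis finite_imageI Max_ge imageI)
  \<comment> \<open>The length of the interval from \<open>- l\<close> to \<open>l\<close>, which
    contains \<open>J\<close>. On it, \<open>x\<close> agrees with a point \<open>z\<close> of
    \<open>X\<close> moved by \<open>i + l\<close>.\<close>
  let ?n = "nat (2 * l + 1)"
  obtain z i where z: "z \<in> X" "block x (- l) ?n = block z i ?n"
    using assms(3)[of "- l" ?n] by (auto simp: language_def occurs_in_iff_block)
  have "z (j + (i + l)) = x j" if "j \<in> J" for j
  proof -
    have "nat (j + l) < ?n" using l[OF that] by linarith
    then have "block x (- l) ?n ! nat (j + l) = x j" "block z i ?n ! nat (j + l) = z (j + (i + l))"
      using l[OF that] by (auto simp: ac_simps)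
    then show ?thesis using z(2) by simp
  qed
  moreover have "(\<lambda>j. z (j + (i + l))) \<in> X"
    using translate_closed z(1) assms(1) by (auto simp: two_sided_shift_def)
  ultimately show "\<exists>y\<in>X. \<forall>j\<in>J. y j = x j" by (intro bexI[of _ "\<lambda>j. z (j + (i + l))"]) auto
qed

text \<open>A one-sided shift is given as the restriction of a two-sided one, so closedness has to
  be proved: a continuous image of a compact set in a Hausdorff space is closed.\<close>

lemma one_sided_shift_closed:
  assumes "one_sided_shift A X"
  shows "closedin (full_shift_topology A) X" "finite A" "shift ` X \<subseteq> X"
proof -
  obtain Z :: "(int \<Rightarrow> 'a) set" where Z: "two_sided_shift A Z" "X = (\<lambda>x n. x (int n)) ` Z"
    using assms by (auto simp: one_sided_shift_def)
  then show "finite A" by (auto simp: two_sided_shift_def)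
  have "compactin (full_shift_topology A) Z"
    using compactin_full_shift Z by (auto simp: two_sided_shift_def)
  moreover have "continuous_map (full_shift_topology A) (full_shift_topology A)
      (\<lambda>x n. x (int n))"
    unfolding full_shift_topology_def
    by (intro continuous_map_coordinatewise_then_product continuous_map_product_projection) auto
  ultimately have "compactin (full_shift_topology A) X"
    unfolding Z(2) by (rule image_compactin)
  moreover have "Hausdorff_space (full_shift_topology A :: (nat \<Rightarrow> 'a) topology)"
    unfolding full_shift_topology_def by (simp add: Hausdorff_space_product_topology)
  ultimately show "closedin (full_shift_topology A) X"
    by (simp add: compactin_imp_closedin)
  show "shift ` X \<subseteq> X"
  proof
    fix y assume "y \<in> shift ` X"
    then obtain z where z: "z \<in> Z" "y = shift (\<lambda>n. z (int n))" using Z(2) by blast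
    then have "shift z \<in> Z" using Z(1) by (auto simp: two_sided_shift_def)
    moreover have "y = (\<lambda>n. shift z (int n))" using z(2) by (auto simp: shift_def ac_simps)
    ultimately show "y \<in> X" using Z(2) by blast
  qed
qed

lemma one_sided_shift_range:
  assumes "one_sided_shift A X" "x \<in> X"
  shows "range x \<subseteq> A"
proof -
  have "X \<subseteq> topspace (full_shift_topology A)"
    using one_sided_shift_closed(1)[OF assms(1)] by (rule closedin_subset)
  then show ?thesis using assms(2) by (auto simp: topspace_full_shift)
qed

lemma one_sided_shiftI_language:
  fixes x :: "nat \<Rightarrow> 'a"
  assumes "one_sided_shift A X" "range x \<subseteq> A" "\<And>i n. block x i n \<in> language X"
  shows "x \<in> X"
proof (rule closedin_full_shift_approx)
  show "closedin (full_shift_topology A) X" using assms(1) by (rule one_sided_shift_closed)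
  show "range x \<subseteq> A" by fact
  fix J :: "nat set" assume "finite J"
  then obtain n where n: "\<And>j. j \<in> J \<Longrightarrow> j < n"
    by (metis finite_nat_set_iff_bounded)
  obtain z i where z: "z \<in> X" "block x 0 n = block z i n"
    using assms(3)[of 0 n] by (auto simp: language_def occurs_in_iff_block)
  have "(\<lambda>j. z (j + i)) \<in> X"
  proof (induction i)
    case (Suc i)
    then have "shift (\<lambda>j. z (j + i)) \<in> X" using one_sided_shift_closed(3)[OF assms(1)] by blast
    then show ?case by (simp add: shift_def)
  qed (simp add: z)
  moreover have "z (j + i) = x j" if "j \<in> J" for j
    using n[OF that] z(2) nth_block[of j n x 0] nth_block[of j n z i] by (simp add: ac_simps)
  ultimately show "\<exists>y\<in>X. \<forall>j\<in>J. y j = x j" by (intro bexI[of _ "\<lambda>j. z (j + i)"]) auto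
qed


text \<open>The common end of the one-sided and the two-sided case: the index type enters only
  through the fact that \<open>X\<close> is determined by its language.\<close>

lemma biclosing_imp_finite_type:
  fixes X :: "('i::semiring_1 \<Rightarrow> 'a) set"
  assumes "finite A" "\<And>x. x \<in> X \<Longrightarrow> range x \<subseteq> A"
    and "\<And>x. range x \<subseteq> A \<Longrightarrow> (\<And>i n. block x i n \<in> language X) \<Longrightarrow> x \<in> X"
    and irr: "\<not> reducible_graph (past_set_cover X)"
    and "biclosing E D" and lang: "language X = run_words E"
  shows "finite_type A X"
proof -
  interpret biclosing E D by fact
  have "x @ y @ z \<in> language X"
    if "x @ y \<in> language X" "y @ z \<in> language X" "length y = 2 * D" for x y z
    unfolding lang
  proof (rule glue_words)
    show "\<exists>u. u @ m \<in> run_words E \<and> (\<forall>w\<in>run_words E. w @ u @ m \<in> run_words E)"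
      if "m \<in> run_words E" for m
      using irreducible_past_set_cover_prolong[OF irr, of m] that lang by simp
  qed (use that lang in auto)
  then show ?thesis using assms by (intro finite_type_if_glue[where n = "2 * D"]) blast+
qed

text \<open>The word \<open>[]\<close> occurs in every sequence, so forbidding it leaves nothing.
  This rules out the empty shift, whose language lacks \<open>[]\<close> whereas
  \<open>run_words\<close> never does.\<close>

lemma finite_type_empty: "finite_type A {}"
  unfolding finite_type_def by (intro exI[of _ "{[]}"]) (auto simp: occurs_in_def)


section \<open>Infinite runs and irreducible components\<close>

definition rrun :: "('v, 'a) edges \<Rightarrow> (nat \<Rightarrow> 'a) \<Rightarrow> (nat \<Rightarrow> 'v) \<Rightarrow> bool" where
  "rrun E x r \<longleftrightarrow> (\<forall>n. (r n, x n, r (Suc n)) \<in> E)"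

lemma rrun_mono: "rrun E x r \<Longrightarrow> E \<subseteq> E' \<Longrightarrow> rrun E' x r"
  by (auto simp: rrun_def)

lemma rrun_append:
  assumes "run E w r" "rrun E x s" "r (length w) = s 0"
  shows "rrun E (\<lambda>n. if n < length w then w ! n else x (n - length w))
    (\<lambda>n. if n < length w then r n else s (n - length w))"
  unfolding rrun_def
proof
  fix n
  consider "Suc n < length w" | "Suc n = length w" | "length w \<le> n" by linarith
  then show "(if n < length w then r n else s (n - length w),
      if n < length w then w ! n else x (n - length w),
      if Suc n < length w then r (Suc n) else s (Suc n - length w)) \<in> E"
  proof cases
    case 1
    then have "n < length w" by simp
    then have "(r n, w ! n, r (Suc n)) \<in> E" using assms(1) unfolding run_def by blast
    then show ?thesis using 1 by simp
  next
    case 2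
    then have "n < length w" by simp
    then have "(r n, w ! n, r (Suc n)) \<in> E" using assms(1) unfolding run_def by blast
    then show ?thesis using 2 assms(3) by simp
  next
    case 3 then show ?thesis using assms(2) by (simp add: rrun_def Suc_diff_le)
  qed
qed

text \<open>The path leaving \<open>s\<close> could be empty, so the edge known to exist is appended
  before the first edge is taken.\<close>

lemma strongly_connected_out_edge:
  assumes "strongly_connected_edges E" "s \<in> states E"
  shows "\<exists>a t. (s, a, t) \<in> E"
proof -
  obtain b c d where e: "(b, c, d) \<in> E" using assms(2) by (auto simp: states_def)
  then have "b \<in> states E" by (auto simp: states_def)
  then obtain w where "connects E s w b"
    using assms by (auto simp: strongly_connected_edges_def)
  then have "connects E s (w @ [c]) d" using connects_edge[OF e] by (rule connects_append)
  then obtain r where "run E (w @ [c]) r" "r 0 = s" by (auto simp: connects_def)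
  then show ?thesis by (auto simp: run_def)
qed

lemma strongly_connected_rrun:
  assumes "strongly_connected_edges E" "s \<in> states E"
  shows "\<exists>x r. rrun E x r \<and> r 0 = s"
proof -
  obtain a t where at: "\<And>s. s \<in> states E \<Longrightarrow> (s, a s, t s) \<in> E"
    using strongly_connected_out_edge[OF assms(1)] by metis
  have st: "(t ^^ n) s \<in> states E" for n
  proof (induction n)
    case 0 then show ?case using assms by simp
  next
    case (Suc n) then show ?case using at[OF Suc] by (auto simp: states_def)
  qed
  have "rrun E (\<lambda>n. a ((t ^^ n) s)) (\<lambda>n. (t ^^ n) s)"
    unfolding rrun_def using at st by simp
  then show ?thesis by (intro exI) auto
qed

text \<open>
  If every state \<open>q\<close> missed some word, a word containing all the missed words, repeated more often
  than there are states, would force a run through some \<open>q\<close> twice with the word missed by \<open>q\<close> in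
  between.
\<close>

lemma irreducible_language_state:
  assumes "finite E" "L \<subseteq> run_words E" "L \<noteq> {}"
    and irr: "\<And>u w. u \<in> L \<Longrightarrow> w \<in> L \<Longrightarrow> \<exists>v. u @ v @ w \<in> L"
  shows "\<exists>q. \<forall>w\<in>L. \<exists>e f. connects E q (e @ w @ f) q"
proof (rule ccontr)
  assume "\<not> ?thesis"
  then obtain m where m: "\<And>q. m q \<in> L" "\<And>q e f. \<not> connects E q (e @ m q @ f) q" by metis
  have m_ne: "m q \<noteq> []" for q using m(2)[of q "[]" "[]"] by auto
  have "\<exists>W\<in>L. \<forall>q\<in>Q. \<exists>e f. W = e @ m q @ f" if "finite Q" for Q
    using that
  proof (induction Q)
    case empty then show ?case using assms(3) by blast
  next
    case (insert q Q)
    then obtain W where W: "W \<in> L" "\<forall>q\<in>Q. \<exists>e f. W = e @ m q @ f" by blast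
    then obtain v where v: "W @ v @ m q \<in> L" using irr m(1) by blast
    have "\<exists>e f. W @ v @ m q = e @ m p @ f" if p: "p \<in> insert q Q" for p
    proof (cases "p = q")
      case True then show ?thesis by (intro exI[of _ "W @ v"] exI[of _ "[]"]) simp
    next
      case False
      then obtain e f where "W = e @ m p @ f" using W p by blast
      then show ?thesis by (intro exI[of _ e] exI[of _ "f @ v @ m q"]) simp
    qed
    then show ?case using v by blast
  qed
  \<comment> \<open>Adding \<open>undefined\<close> guarantees that \<open>W\<close> contains at
    least one missed word, and so is nonempty, even if \<open>states E\<close> were empty.\<close>
  then obtain W where W: "W \<in> L" "\<And>q. q \<in> insert undefined (states E) \<Longrightarrow> \<exists>e f. W = e @ m q @ f"
    using finite_states[OF assms(1)] by (metis finite_insert)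
  have W_ne: "W \<noteq> []" using W(2)[of undefined] m_ne by auto
  have "\<exists>z\<in>L. \<exists>p. (\<forall>k<n. p k + length W \<le> length z \<and> take (length W) (drop (p k) z) = W) \<and>
    (\<forall>j<n. \<forall>i<j. p i + length W \<le> p j)" for n :: nat
  proof (induction n)
    case 0 then show ?case using W by auto
  next
    case (Suc n)
    then obtain z p where z: "z \<in> L"
      "\<And>k. k < n \<Longrightarrow> p k + length W \<le> length z \<and> take (length W) (drop (p k) z) = W"
      "\<And>i j. j < n \<Longrightarrow> i < j \<Longrightarrow> p i + length W \<le> p j" by blast
    then obtain v where v: "z @ v @ W \<in> L" using irr W(1) by blast
    define p' where "p' = p(n := length (z @ v))"
    have "p' k + length W \<le> length (z @ v @ W) \<and> take (length W) (drop (p' k) (z @ v @ W)) = W"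
      if "k < Suc n" for k
    proof (cases "k = n")
      case False
      then have "k < n" using that by simp
      from z(2)[OF this] show ?thesis using False by (simp add: p'_def)
    qed (simp add: p'_def)
    moreover have "p' i + length W \<le> p' j" if "j < Suc n" "i < j" for i j
    proof (cases "j = n")
      case True
      then show ?thesis using that z(2)[of i] by (simp add: p'_def)
    next
      case False
      then show ?thesis using that z(3)[of j i] by (simp add: p'_def)
    qed
    ultimately show ?case using v by blast
  qed
  from this[of "Suc (card (states E))"] obtain z p where z: "z \<in> L"
    "\<And>k. k \<le> card (states E) \<Longrightarrow>
      p k + length W \<le> length z \<and> take (length W) (drop (p k) z) = W"
    "\<And>i j. j \<le> card (states E) \<Longrightarrow> i < j \<Longrightarrow> p i + length W \<le> p j"
    by (metis less_Suc_eq_le)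
  obtain r where r: "run E z r" using z(1) assms(2) by (auto simp: run_words_def)
  have "z \<noteq> []" using z(2)[of 0] W_ne by auto
  then have "r (p k) \<in> states E" if "k \<le> card (states E)" for k
    using run_state[OF r] z(2)[OF that] by simp
  then have "(\<lambda>k. r (p k)) ` {..card (states E)} \<subseteq> states E" by auto
  then have "\<not> inj_on (\<lambda>k. r (p k)) {..card (states E)}"
    using card_inj_on_le[OF _ _ finite_states[OF assms(1)]] by fastforce
  then obtain i j where ij: "i < j" "j \<le> card (states E)" "r (p i) = r (p j)"
    unfolding inj_on_def by (metis atMost_iff linorder_neqE_nat)
  define q where "q = r (p i)"
  \<comment> \<open>The copies of \<open>W\<close> do not overlap, so this loop at \<open>q\<close>
    starts with a complete copy of \<open>W\<close> and contains the word missed by its own base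
    state.\<close>
  let ?w = "take (p j - p i) (drop (p i) z)"
  have le: "p i + length W \<le> p j" "p j \<le> length z" using z(3)[OF ij(2,1)] z(2)[OF ij(2)] by auto
  then have closed: "connects E q ?w q"
    unfolding q_def using connects_slice[OF r, of "p i" "p j"] ij by simp
  have "take (length W) ?w = take (length W) (drop (p i) z)" using le by (simp add: min_def)
  then have "take (length W) ?w = W" using z(2)[of i] ij by simp
  then have W_split: "?w = W @ drop (length W) ?w" by (metis append_take_drop_id)
  have "q \<in> states E" unfolding q_def
    by (rule run_state[OF r]) (use \<open>z \<noteq> []\<close> le in auto)
  then obtain e f where "W = e @ m q @ f" using W(2) by blast
  then have "?w = e @ m q @ f @ drop (length W) ?w" using W_split by simp
  then show False using m(2) closed by metis
qed

text \<open>The edges lying on closed runs through \<open>q\<close>.\<close>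

definition component :: "('v, 'a) edges \<Rightarrow> 'v \<Rightarrow> ('v, 'a) edges" where
  "component E q = {(s, a, t) \<in> E. (\<exists>w. connects E q w s) \<and> (\<exists>w. connects E t w q)}"

lemma component_subset: "component E q \<subseteq> E"
  by (auto simp: component_def)

lemma run_component:
  assumes r: "run E w r" and "connects E q u (r 0)" "connects E (r (length w)) v q"
  shows "run (component E q) w r"
  unfolding run_def
proof (intro allI impI)
  fix i assume i: "i < length w"
  have "connects E (r 0) (take i w) (r i)" using connects_slice[OF r, of 0 i] i by simp
  then have "\<exists>w. connects E q w (r i)" using connects_append[OF assms(2)] by blast
  moreover have "connects E (r (Suc i)) (take (length w - Suc i) (drop (Suc i) w)) (r (length w))"
    using connects_slice[OF r, of "Suc i" "length w"] i by simp
  then have "\<exists>w. connects E (r (Suc i)) w q" using connects_append[OF _ assms(3)] by blast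
  ultimately show "(r i, w ! i, r (Suc i)) \<in> component E q"
    using r i by (auto simp: component_def run_def)
qed

lemma connects_component:
  assumes "connects E s w t" "connects E q u s" "connects E t v q"
  shows "connects (component E q) s w t"
proof -
  obtain r where r: "run E w r" "r 0 = s" "r (length w) = t"
    using assms(1) by (auto simp: connects_def)
  then have "run (component E q) w r" using assms(2,3) by (intro run_component) simp_all
  then show ?thesis using r by (auto simp: connects_def)
qed

lemma strongly_connected_component: "strongly_connected_edges (component E q)"
proof -
  have st: "(\<exists>w. connects E q w s) \<and> (\<exists>w. connects E s w q)"
    if s: "s \<in> states (component E q)" for s
  proof -
    consider a t where "(s, a, t) \<in> component E q" | a t where "(t, a, s) \<in> component E q"
      using s unfolding states_def by blast
    then show ?thesis
    proof cases
      case 1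
      then have "connects E s [a] t" by (auto simp: component_def intro: connects_edge)
      then show ?thesis using 1 by (auto simp: component_def intro: connects_append)
    next
      case 2
      then have "connects E t [a] s" by (auto simp: component_def intro: connects_edge)
      then show ?thesis using 2 by (auto simp: component_def intro: connects_append)
    qed
  qed
  show ?thesis
    unfolding strongly_connected_edges_def
  proof (intro ballI)
    fix s t assume "s \<in> states (component E q)" "t \<in> states (component E q)"
    then obtain u u' v v' where u: "connects E q u s" and u': "connects E s u' q"
      and v: "connects E q v t" and v': "connects E t v' q"
      using st[of s] st[of t] by metis
    show "\<exists>w. connects (component E q) s w t"
      using connects_component[OF connects_append[OF u' v] u v'] by (rule exI)
  qed
qed

lemma run_words_component:
  assumes "connects E q (e @ w @ f) q"
  shows "w \<in> run_words (component E q)"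
proof -
  have "connects (component E q) q (e @ w @ f) q"
    using connects_component[OF assms, of q "[]" "[]"] by simp
  then have "e @ w @ f \<in> run_words (component E q)" by (auto simp: connects_def run_words_def)
  then show ?thesis by (rule run_words_infix)
qed


section \<open>One-sided shifts\<close>

text \<open>Arc names are forgotten: parallel arcs with one label are merged, and isolated vertices
  disappear.\<close>

definition edges_of :: "('v, 'e) pre_digraph \<Rightarrow> ('e \<Rightarrow> 'a) \<Rightarrow> ('v, 'a) edges" where
  "edges_of G lab = (\<lambda>e. (tail G e, lab e, head G e)) ` arcs G"

lemma run_Cons: "run E (a # w) r \<longleftrightarrow> (r 0, a, r 1) \<in> E \<and> run E w (\<lambda>i. r (Suc i))"
  by (auto simp: run_def less_Suc_eq_0_disj)

text \<open>\<open>r 0 \<in> verts G\<close> makes the empty walk legitimate. The last conclusion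
  turns equality of first arcs into equality of second states, the form of closing used for
  runs.\<close>

lemma run_edges_of_awalk:
  assumes "wf_digraph G" "run (edges_of G lab) w r" "r 0 \<in> verts G"
  shows "\<exists>p. length p = length w \<and> map lab p = w \<and> pre_digraph.awalk G (r 0) p (r (length w))
    \<and> (w \<noteq> [] \<longrightarrow> head G (hd p) = r 1)"
  using assms(2,3)
proof (induction w arbitrary: r)
  case Nil
  then show ?case
    by (intro exI[of _ "[]"]) (simp add: pre_digraph.awalk_def pre_digraph.cas.simps)
next
  case (Cons a w)
  then obtain e where e: "e \<in> arcs G" "tail G e = r 0" "lab e = a" "head G e = r (Suc 0)"
    by (auto simp: run_Cons edges_of_def)
  then have "r (Suc 0) \<in> verts G" using assms(1) by (metis wf_digraph.head_in_verts)
  then obtain p where "length p = length w" "map lab p = w"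
    "pre_digraph.awalk G (r (Suc 0)) p (r (Suc (length w)))"
    using Cons.IH[of "\<lambda>i. r (Suc i)"] Cons.prems by (auto simp: run_Cons)
  then show ?case using e Cons.prems
    by (intro exI[of _ "e # p"]) (auto simp: pre_digraph.awalk_def pre_digraph.cas.simps)
qed

lemma right_closing_edges_of:
  assumes "wf_digraph G" "right_closing G lab"
  shows "\<exists>D. right_closed D (edges_of G lab)"
proof -
  obtain D where D: "\<And>u v w p q. pre_digraph.awalk G u p v \<Longrightarrow> pre_digraph.awalk G u q w \<Longrightarrow>
    length p = D + 1 \<Longrightarrow> length q = D + 1 \<Longrightarrow> map lab p = map lab q \<Longrightarrow> hd p = hd q"
    using assms(2) unfolding right_closing_def by blast
  have "r 1 = s 1" if *: "run (edges_of G lab) w r" "run (edges_of G lab) w s"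
    "length w = Suc D" "r 0 = s 0" for w r s
  proof -
    have ne: "w \<noteq> []" using * by auto
    then have "(r 0, w ! 0, r 1) \<in> edges_of G lab" using *(1) by (simp add: run_def)
    then have v: "r 0 \<in> verts G"
      using assms(1) by (auto simp: edges_of_def wf_digraph.tail_in_verts)
    obtain p where p: "length p = length w" "map lab p = w"
      "pre_digraph.awalk G (r 0) p (r (length w))" "head G (hd p) = r 1"
      using run_edges_of_awalk[OF assms(1) *(1) v] ne by blast
    obtain q where q: "length q = length w" "map lab q = w"
      "pre_digraph.awalk G (s 0) q (s (length w))" "head G (hd q) = s 1"
      using run_edges_of_awalk[OF assms(1) *(2)] v ne *(4) by metis
    have "hd p = hd q" using D[OF p(3) q(3)[folded *(4)]] p q * by simp
    then show ?thesis using p q by simp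
  qed
  then show ?thesis unfolding right_closed_def by blast
qed

lemma left_resolving_edges_of:
  assumes "left_resolving G lab"
  shows "left_closed 0 (edges_of G lab)"
  unfolding left_closed_def
proof (intro allI impI, elim conjE)
  fix w r s
  assume *: "run (edges_of G lab) w r" "run (edges_of G lab) w s" "length w = Suc 0"
    "r (Suc 0) = s (Suc 0)"
  then have "(r 0, w ! 0, r (Suc 0)) \<in> edges_of G lab" "(s 0, w ! 0, s (Suc 0)) \<in> edges_of G lab"
    by (auto simp: run_def)
  then obtain e f where "e \<in> arcs G" "f \<in> arcs G" "tail G e = r 0" "tail G f = s 0"
    "head G e = head G f" "lab e = lab f" using *(4) by (auto simp: edges_of_def)
  then show "r 0 = s 0" using assms unfolding left_resolving_def by metis
qed

text \<open>Only an inclusion: a finite run may end where no infinite path starts, and then its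
  label need not occur in \<open>X\<close>.\<close>

lemma one_sided_language_edges_of:
  fixes X :: "(nat \<Rightarrow> 'a) set"
  assumes "presents G lab X"
  shows "language X \<subseteq> run_words (edges_of G lab)"
proof
  fix w assume "w \<in> language X"
  then obtain x where x: "x \<in> X" "occurs_in w x" by (auto simp: language_def)
  then obtain p where "infinite_path G p" and lab: "x = lab \<circ> p"
    using assms by (auto simp: presents_def)
  then have p: "range p \<subseteq> arcs G" "\<And>i. head G (p i) = tail G (p (Suc i))"
    by (auto simp: infinite_path_def)
  obtain i where w: "\<And>k. k < length w \<Longrightarrow> w ! k = lab (p (i + k))"
    using x(2) lab by (auto simp: occurs_in_def)
  have "run (edges_of G lab) w (\<lambda>k. tail G (p (i + k)))"
    unfolding run_def using p w by (force simp: edges_of_def image_iff)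
  then show "w \<in> run_words (edges_of G lab)" by (auto simp: run_words_def)
qed

lemma rrun_edges_of_presented:
  fixes X :: "(nat \<Rightarrow> 'a) set"
  assumes "presents G lab X" "rrun (edges_of G lab) x r"
  shows "x \<in> X"
proof -
  have "\<forall>n. \<exists>e\<in>arcs G. tail G e = r n \<and> lab e = x n \<and> head G e = r (Suc n)"
  proof
    fix n
    have "(r n, x n, r (Suc n)) \<in> edges_of G lab" using assms(2) by (simp add: rrun_def)
    then show "\<exists>e\<in>arcs G. tail G e = r n \<and> lab e = x n \<and> head G e = r (Suc n)"
      by (auto simp: edges_of_def)
  qed
  then obtain p where p: "\<And>n. p n \<in> arcs G \<and> tail G (p n) = r n \<and> lab (p n) = x n
    \<and> head G (p n) = r (Suc n)" by metis
  then have "infinite_path G p" by (auto simp: infinite_path_def)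
  moreover have "x = lab \<circ> p" using p by auto
  ultimately show ?thesis using assms(1) by (auto simp: presents_def)
qed

text \<open>Irreducibility of the cover is not established. Instead, a state \<open>q\<close> whose
  loops see every word of the language is found, and its component inherits both closing conditions.
  Strong connectedness prolongs every run in the component to an infinite one, so no words are
  added.\<close>

lemma one_sided_AFT_biclosing:
  fixes X :: "(nat \<Rightarrow> 'a) set"
  assumes "irreducible_shift X" "one_sided_AFT X" "X \<noteq> {}"
  shows "\<exists>(E :: (nat, 'a) edges) D. biclosing E D \<and> language X = run_words E"
proof -
  obtain G :: "(nat, nat) pre_digraph" and lab
    where G: "presents G lab X" "left_resolving G lab" "right_closing G lab"
    using assms(2) by (auto simp: one_sided_AFT_def left_fischer_cover_def)
  then interpret fin_digraph G by (simp add: presents_def)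
  let ?E = "edges_of G lab"
  have fin: "finite ?E" by (simp add: edges_of_def)
  obtain x where x: "x \<in> X" using assms(3) by blast
  have Nil: "[] \<in> language X" using x by (auto simp: language_def occurs_in_def)
  then have ne: "language X \<noteq> {}" by blast
  have "\<exists>v. u @ v @ w \<in> language X" if "u \<in> language X" "w \<in> language X" for u w
    using assms(1) that unfolding irreducible_shift_def by blast
  then obtain q where q: "\<forall>w\<in>language X. \<exists>e f. connects ?E q (e @ w @ f) q"
    using irreducible_language_state[OF fin one_sided_language_edges_of[OF G(1)] ne] by blast
  let ?C = "component ?E q"
  obtain D where D: "right_closed D ?E" using right_closing_edges_of[OF wf_digraph_axioms G(3)] by blast
  have "biclosing ?C (Suc D)"
  proof
    show "finite ?C" using fin component_subset by (rule finite_subset[rotated])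
    show "strongly_connected_edges ?C" by (rule strongly_connected_component)
    show "right_closed (Suc D) ?C"
      using right_closed_mono[OF right_closed_subset[OF D component_subset]] by simp
    show "left_closed (Suc D) ?C"
      using left_closed_mono[OF left_closed_subset[OF left_resolving_edges_of[OF G(2)] component_subset]]
      by simp
  qed simp
  moreover have "language X = run_words ?C"
  proof (intro subset_antisym subsetI)
    fix w assume "w \<in> language X"
    then show "w \<in> run_words ?C" using q by (auto intro: run_words_component)
  next
    fix w assume "w \<in> run_words ?C"
    then obtain r where r: "run ?C w r" by (auto simp: run_words_def)
    show "w \<in> language X"
    proof (cases "w = []")
      case False
      then have "r (length w) \<in> states ?C" using run_state[OF r] by simp
      then obtain x s where "rrun ?C x s" "s 0 = r (length w)"
        using strongly_connected_rrun[OF strongly_connected_component] by metis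
      then have "rrun ?C (\<lambda>n. if n < length w then w ! n else x (n - length w))
          (\<lambda>n. if n < length w then r n else s (n - length w))" (is "rrun _ ?x ?s")
        using rrun_append[OF r] by simp
      then have "rrun ?E ?x ?s" using component_subset by (rule rrun_mono)
      then have "?x \<in> X" using rrun_edges_of_presented[OF G(1)] by blast
      moreover have "occurs_in w ?x" unfolding occurs_in_def by (intro exI[of _ 0]) simp
      ultimately show ?thesis by (auto simp: language_def)
    qed (simp add: Nil)
  qed
  ultimately show ?thesis by blast
qed


section \<open>Closing from injectivity at a state\<close>

text \<open>Reversal turns left closing into right closing and left-infinite runs into
  right-infinite ones.\<close>

definition converse_edges :: "('v, 'a) edges \<Rightarrow> ('v, 'a) edges" where
  "converse_edges E = {(t, a, s) |s a t. (s, a, t) \<in> E}"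

lemma converse_edges_iff [simp]: "(t, a, s) \<in> converse_edges E \<longleftrightarrow> (s, a, t) \<in> E"
  by (simp add: converse_edges_def)

lemma finite_converse_edges: "finite E \<Longrightarrow> finite (converse_edges E)"
proof -
  have "converse_edges E = (\<lambda>(s, a, t). (t, a, s)) ` E"
    by (force simp: converse_edges_def)
  then show "finite E \<Longrightarrow> finite (converse_edges E)" by simp
qed

lemma states_converse_edges [simp]: "states (converse_edges E) = states E"
  by (auto simp: states_def)

lemma run_converse_edges:
  assumes "run E w r"
  shows "run (converse_edges E) (rev w) (\<lambda>i. r (length w - i))"
  unfolding run_def
proof (intro allI impI)
  fix i assume "i < length (rev w)"
  then have "length w - Suc i < length w" "length w - i = Suc (length w - Suc i)"
    "rev w ! i = w ! (length w - Suc i)" by (auto simp: rev_nth)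
  then show "(r (length w - i), rev w ! i, r (length w - Suc i)) \<in> converse_edges E"
    using assms unfolding run_def by (metis converse_edges_iff)
qed

lemma strongly_connected_converse_edges:
  assumes "strongly_connected_edges E"
  shows "strongly_connected_edges (converse_edges E)"
  unfolding strongly_connected_edges_def
proof (intro ballI)
  fix s t assume "s \<in> states (converse_edges E)" "t \<in> states (converse_edges E)"
  then obtain w where "connects E t w s"
    using assms by (auto simp: strongly_connected_edges_def)
  then obtain r where "run E w r" "r 0 = t" "r (length w) = s" by (auto simp: connects_def)
  then have "connects (converse_edges E) s (rev w) t"
    unfolding connects_def by (intro exI[of _ "\<lambda>i. r (length w - i)"]) (simp add: run_converse_edges)
  then show "\<exists>w. connects (converse_edges E) s w t" ..
qed

lemma left_closed_if_converse_right_closed: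
  assumes "right_closed D (converse_edges E)"
  shows "left_closed D E"
  unfolding left_closed_def
proof (intro allI impI, elim conjE)
  fix w r s
  assume *: "run E w r" "run E w s" "length w = Suc D" "r (Suc D) = s (Suc D)"
  have "run (converse_edges E) (rev w) (\<lambda>i. r (Suc D - i))"
    "run (converse_edges E) (rev w) (\<lambda>i. s (Suc D - i))"
    using run_converse_edges[OF *(1)] run_converse_edges[OF *(2)] *(3) by simp_all
  then have "r (Suc D - 1) = s (Suc D - 1)"
    using assms * unfolding right_closed_def by (metis diff_zero length_rev)
  then show "r D = s D" by simp
qed

section \<open>Bi-infinite runs\<close>

definition birun :: "('v, 'a) edges \<Rightarrow> (int \<Rightarrow> 'a) \<Rightarrow> (int \<Rightarrow> 'v) \<Rightarrow> bool" where
  "birun E x r \<longleftrightarrow> (\<forall>i. (r i, x i, r (i + 1)) \<in> E)"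

text \<open>A label has the index of the earlier of its two positions, hence the extra
  \<open>- 1\<close> on labels but not on states.\<close>

lemma birun_converse_edges:
  assumes "birun (converse_edges E) x r"
  shows "birun E (\<lambda>i. x (- i - 1)) (\<lambda>i. r (- i))"
  unfolding birun_def
proof
  fix i
  have "(r (- i - 1), x (- i - 1), r (- i - 1 + 1)) \<in> converse_edges E"
    using assms unfolding birun_def by blast
  then show "(r (- i), x (- i - 1), r (- (i + 1))) \<in> E" by simp
qed

lemma birun_glue:
  assumes "rrun (converse_edges E) x r" "rrun E y s" "r 0 = s 0"
  shows "birun E (\<lambda>i. if 0 \<le> i then y (nat i) else x (nat (- i - 1)))
    (\<lambda>i. if 0 \<le> i then s (nat i) else r (nat (- i)))"
  unfolding birun_def
proof
  fix i :: int
  have x: "(r (Suc n), x n, r n) \<in> E" for n using assms(1) by (simp add: rrun_def)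
  have y: "(s n, y n, s (Suc n)) \<in> E" for n using assms(2) by (simp add: rrun_def)
  consider "0 \<le> i" | "i = -1" | "i < -1" by linarith
  then show "(if 0 \<le> i then s (nat i) else r (nat (- i)),
      if 0 \<le> i then y (nat i) else x (nat (- i - 1)),
      if 0 \<le> i + 1 then s (nat (i + 1)) else r (nat (- (i + 1)))) \<in> E"
  proof cases
    case 1 then show ?thesis using y[of "nat i"] by (simp add: nat_add_distrib)
  next
    case 2 then show ?thesis using x[of 0] assms(3) by simp
  next
    case 3
    then have "nat (- i) = Suc (nat (- i - 1))" "nat (- (i + 1)) = nat (- i - 1)" by auto
    then show ?thesis using x[of "nat (- i - 1)"] 3 by simp
  qed
qed

text \<open>
  Two long runs that separate in their first step repeat a pair of states, hence yield two
  infinite runs with one label. Both can be prolonged to the left through \<open>u\<close>.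
\<close>

lemma right_closed_if_unique_biruns:
  assumes fin: "finite E" and conn: "strongly_connected_edges E" and u: "u \<in> states E"
    and uniq: "\<And>x r s. birun E x r \<Longrightarrow> birun E x s \<Longrightarrow> r 0 = u \<Longrightarrow> s 0 = u \<Longrightarrow> r = s"
  shows "\<exists>D. right_closed D E"
proof -
  \<comment> \<open>The \<open>D + 1\<close> pairs of states at positions \<open>1\<close> to
    \<open>D + 1\<close> cannot all be distinct.\<close>
  define D where "D = card (states E \<times> states E)"
  have "r 1 = s 1" if *: "run E w r" "run E w s" "length w = Suc D" "r 0 = s 0" for w r s
  proof -
    have w: "w \<noteq> []" using * by auto
    \<comment> \<open>Pairs are taken from position \<open>1\<close> on, so that the loop found
      leaves the first step, where the runs might separate, in place.\<close>
    let ?g = "\<lambda>k. (r (Suc k), s (Suc k))"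
    have "?g ` {..D} \<subseteq> states E \<times> states E"
      using run_state[OF *(1) w] run_state[OF *(2) w] *(3) by auto
    moreover have "finite (states E \<times> states E)" using finite_states[OF fin] by simp
    ultimately have "\<not> inj_on ?g {..D}"
      using card_inj_on_le[of ?g "{..D}" "states E \<times> states E"] unfolding D_def by fastforce
    then obtain i j where ij: "i < j" "j \<le> D" "?g i = ?g j"
      unfolding inj_on_def by (metis (no_types, lifting) atMost_iff linorder_neqE_nat)
    \<comment> \<open>Positions in \<open>w\<close> visited by the infinite runs: \<open>0\<close>
      to \<open>j\<close>, then \<open>Suc i\<close> to \<open>j\<close> again and again. The jump
      is harmless since the states at \<open>Suc j\<close> equal those at
      \<open>Suc i\<close>.\<close>
    define f where "f n = ((\<lambda>k. if k = j then Suc i else Suc k) ^^ n) 0" for n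
    have f_Suc: "f (Suc n) = (if f n = j then Suc i else Suc (f n))" for n
      by (simp add: f_def)
    have f_le: "f n \<le> j" for n
    proof (induction n)
      case 0 then show ?case by (simp add: f_def)
    next
      case (Suc n) then show ?case using ij(1) by (simp add: f_Suc)
    qed
    have f01: "f 0 = 0" "f (Suc 0) = 1" using ij(1) by (simp_all add: f_def)
    have rr: "rrun E (\<lambda>n. w ! f n) (\<lambda>n. q (f n))"
      if "run E w q" "q (Suc i) = q (Suc j)" for q
      unfolding rrun_def
    proof
      fix n
      have "f n < length w" using f_le[of n] ij(2) *(3) by linarith
      then have "(q (f n), w ! f n, q (Suc (f n))) \<in> E" using that(1) unfolding run_def by blast
      then show "(q (f n), w ! f n, q (f (Suc n))) \<in> E" using that(2) by (cases "f n = j") (simp_all add: f_Suc)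
    qed
    have "r 0 \<in> states E" using run_state[OF *(1) w] by simp
    then obtain e where "connects E u e (r 0)"
      using conn u unfolding strongly_connected_edges_def by blast
    then obtain \<rho> where \<rho>: "run E e \<rho>" "\<rho> 0 = u" "\<rho> (length e) = r 0"
      by (auto simp: connects_def)
    obtain x l where l: "rrun (converse_edges E) x l" "l 0 = u"
      using strongly_connected_rrun[OF strongly_connected_converse_edges[OF conn]] u
      by (metis states_converse_edges)
    define ext where "ext q = (\<lambda>n. if n < length e then \<rho> n else q (f (n - length e)))"
      for q :: "nat \<Rightarrow> 'a"
    define z where "z = (\<lambda>n. if n < length e then e ! n else w ! f (n - length e))"
    have ext: "rrun E z (ext q)" "ext q 0 = u"
      if "run E w q" "q (Suc i) = q (Suc j)" "q 0 = r 0" for q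
      using rrun_append[OF \<rho>(1) rr[OF that(1,2)]] \<rho>(2,3) that(3) f01
      unfolding ext_def z_def by auto
    define bi where "bi q = (\<lambda>k. if 0 \<le> k then ext q (nat k) else l (nat (- k)))"
      for q :: "nat \<Rightarrow> 'a"
    have bi: "birun E (\<lambda>k. if 0 \<le> k then z (nat k) else x (nat (- k - 1))) (bi q)" "bi q 0 = u"
      if "run E w q" "q (Suc i) = q (Suc j)" "q 0 = r 0" for q
      using birun_glue[OF l(1) ext(1)[OF that]] ext(2)[OF that] l(2) unfolding bi_def by auto
    have r: "r (Suc i) = r (Suc j)" and s: "s (Suc i) = s (Suc j)" using ij(3) by auto
    have "bi r = bi s"
      using bi[OF *(1) r] bi[OF *(2) s] *(4) by (intro uniq) auto
    \<comment> \<open>\<open>r 0\<close> sits at position \<open>length e\<close>, so the next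
      position shows \<open>r 1\<close> and \<open>s 1\<close>.\<close>
    then have "bi r (int (Suc (length e))) = bi s (int (Suc (length e)))" by simp
    then show ?thesis unfolding bi_def ext_def by (simp add: f01 nat_add_distrib)
  qed
  then show ?thesis unfolding right_closed_def by blast
qed

text \<open>Uniqueness of bi-infinite runs through \<open>u\<close> is invariant under time
  reversal, so the right-closing result applied to the converse edges gives left closing.\<close>

lemma biclosing_if_unique_biruns:
  assumes fin: "finite E" and conn: "strongly_connected_edges E" and u: "u \<in> states E"
    and uniq: "\<And>x r s. birun E x r \<Longrightarrow> birun E x s \<Longrightarrow> r 0 = u \<Longrightarrow> s 0 = u \<Longrightarrow> r = s"
  shows "\<exists>D. biclosing E D"
proof -
  have "\<exists>D. right_closed D E"
    using fin conn u uniq by (rule right_closed_if_unique_biruns)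
  then obtain D where D: "right_closed D E" ..
  have "\<exists>D. right_closed D (converse_edges E)"
  proof (rule right_closed_if_unique_biruns)
    fix x r s
    assume *: "birun (converse_edges E) x r" "birun (converse_edges E) x s" "r 0 = u" "s 0 = u"
    have "(\<lambda>i. r (- i)) = (\<lambda>i. s (- i))"
      using birun_converse_edges[OF *(1)] birun_converse_edges[OF *(2)] *(3,4)
      by (intro uniq) auto
    then have "r (- (- i)) = s (- (- i))" for i by metis
    then show "r = s" by auto
  qed (use finite_converse_edges[OF fin] strongly_connected_converse_edges[OF conn] u in auto)
  then obtain D' where D': "right_closed D' (converse_edges E)" by blast
  have "biclosing E (Suc (max D D'))"
  proof
    show "right_closed (Suc (max D D')) E" using right_closed_mono[OF D] by simp
    show "left_closed (Suc (max D D')) E"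
      using left_closed_mono[OF left_closed_if_converse_right_closed[OF D']] by simp
  qed (use assms in auto)
  then show ?thesis ..
qed


section \<open>Two-sided shifts\<close>

lemma factor_map_translate:
  fixes y :: "int \<Rightarrow> 'b"
  assumes \<pi>: "factor_map B Y A X \<pi>" and Y: "shift ` Y = Y" and "y \<in> Y"
  shows "\<pi> (\<lambda>i. y (i + n)) = (\<lambda>i. \<pi> y (i + n))"
  using \<open>y \<in> Y\<close>
proof (induction n arbitrary: y rule: int_induct[of _ 0])
  case base then show ?case by simp
next
  case (step1 n)
  have "shift y \<in> Y" using Y step1.prems by blast
  then have "\<pi> (\<lambda>i. shift y (i + n)) = (\<lambda>i. \<pi> (shift y) (i + n))" by (rule step1.IH)
  moreover have "\<pi> (shift y) = shift (\<pi> y)" using \<pi> step1.prems by (auto simp: factor_map_def)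
  ultimately show ?case by (simp add: shift_def ac_simps)
next
  case (step2 n)
  then obtain z where z: "y = shift z" "z \<in> Y" using Y by blast
  then have "\<pi> (\<lambda>i. z (i + n)) = (\<lambda>i. \<pi> z (i + n))" using step2.IH by blast
  moreover have "\<pi> (shift z) = shift (\<pi> z)" using \<pi> z(2) by (auto simp: factor_map_def)
  ultimately show ?case using z(1) by (simp add: shift_def)
qed

text \<open>By continuity each \<open>y\<close> has a finite window \<open>J y\<close> deciding
  coordinate \<open>0\<close> of its image. By compactness finitely many of the cylinders cover
  \<open>Y\<close>; points agreeing on the union of their windows lie in a common cylinder.\<close>

lemma Curtis_Hedlund_Lyndon:
  fixes Y :: "(int \<Rightarrow> 'b) set"
  assumes \<pi>: "factor_map B Y A X \<pi>" and Y: "two_sided_shift B Y"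
    and X: "\<And>x. x \<in> X \<Longrightarrow> range x \<subseteq> A"
  shows "\<exists>J. finite J \<and> (\<forall>y\<in>Y. \<forall>z\<in>Y. (\<forall>j\<in>J. y j = z j) \<longrightarrow> \<pi> y 0 = \<pi> z 0)"
proof -
  let ?T = "full_shift_topology B"
  have cont: "continuous_map (subtopology ?T Y) (subtopology (full_shift_topology A) X) \<pi>"
    and im: "\<pi> ` Y = X" using \<pi> by (auto simp: factor_map_def)
  have cont0: "continuous_map (subtopology ?T Y) (discrete_topology A) (\<lambda>y. \<pi> y 0)"
  proof -
    have "continuous_map (full_shift_topology A) (discrete_topology A) (\<lambda>x. x 0)"
      unfolding full_shift_topology_def by (rule continuous_map_product_projection) simp
    then show ?thesis
      using continuous_map_compose[OF continuous_map_into_fulltopology[OF cont]]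
      by (simp add: comp_def)
  qed
  have YB: "\<And>y. y \<in> Y \<Longrightarrow> range y \<subseteq> B" using two_sided_shift_range[OF Y] .
  have "\<exists>J. finite J \<and> (\<forall>z\<in>Y. (\<forall>j\<in>J. z j = y j) \<longrightarrow> \<pi> z 0 = \<pi> y 0)" if y: "y \<in> Y" for y
  proof -
    have "\<pi> y 0 \<in> A" using X im y by blast
    then have "openin (discrete_topology A) {\<pi> y 0}" by simp
    from openin_continuous_map_preimage[OF cont0 this]
    obtain S where S: "openin ?T S" "{z \<in> topspace (subtopology ?T Y). \<pi> z 0 \<in> {\<pi> y 0}} = S \<inter> Y"
      unfolding openin_subtopology by auto
    have top: "topspace (subtopology ?T Y) = Y" using YB by (auto simp: topspace_full_shift)
    have "y \<in> S" using S(2) y unfolding top by blast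
    then obtain J where J: "finite J" "\<forall>z. range z \<subseteq> B \<and> (\<forall>j\<in>J. z j = y j) \<longrightarrow> z \<in> S"
      using openin_full_shift_cylinder[OF S(1)] by blast
    have "\<pi> z 0 = \<pi> y 0" if "z \<in> Y" "\<forall>j\<in>J. z j = y j" for z
    proof -
      have "z \<in> S \<inter> Y" using J(2) that YB by blast
      then show ?thesis unfolding S(2)[symmetric] by simp
    qed
    then show ?thesis using J(1) by blast
  qed
  then obtain J where J: "\<And>y. y \<in> Y \<Longrightarrow> finite (J y)"
    "\<And>y z. y \<in> Y \<Longrightarrow> z \<in> Y \<Longrightarrow> \<forall>j\<in>J y. z j = y j \<Longrightarrow> \<pi> z 0 = \<pi> y 0" by metis
  define C where "C y = {z. range z \<subseteq> B \<and> (\<forall>j\<in>J y. z j = y j)}" for y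
  have "compactin ?T Y" using compactin_full_shift Y by (auto simp: two_sided_shift_def)
  moreover have "\<forall>S\<in>C ` Y. openin ?T S"
    unfolding C_def using cylinder_openin_full_shift[OF J(1) YB] by blast
  moreover have "Y \<subseteq> \<Union> (C ` Y)" using YB by (auto simp: C_def)
  ultimately obtain F where F: "finite F" "F \<subseteq> C ` Y" "Y \<subseteq> \<Union> F"
    unfolding compactin_def by meson
  then obtain Q where Q: "Q \<subseteq> Y" "finite Q" "F = C ` Q" by (meson finite_subset_image)
  have "\<pi> y 0 = \<pi> z 0" if y: "y \<in> Y" and z: "z \<in> Y" and eq: "\<forall>j\<in>\<Union> (J ` Q). y j = z j" for y z
  proof -
    obtain q where q: "q \<in> Q" "y \<in> C q" using subsetD[OF F(3) y] Q(3) by blast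
    then have "\<forall>j\<in>J q. y j = q j" "\<forall>j\<in>J q. z j = q j" using eq by (auto simp: C_def)
    then have "\<pi> y 0 = \<pi> q 0" "\<pi> z 0 = \<pi> q 0" using J(2)[of q] Q(1) q(1) y z by auto
    then show ?thesis by simp
  qed
  moreover have "finite (\<Union> (J ` Q))" using Q J(1) by auto
  ultimately show ?thesis by blast
qed

lemma finite_int_set_bounded:
  assumes "finite (J :: int set)"
  shows "\<exists>n::nat. \<forall>j\<in>J. \<bar>j\<bar> \<le> int n"
proof -
  obtain l where l: "\<And>j. j \<in> J \<Longrightarrow> \<bar>j\<bar> \<le> l"
    using assms by (metis finite_imageI Max_ge imageI)
  then have "\<bar>j\<bar> \<le> int (nat l)" if "j \<in> J" for j using l[OF that] by linarith
  then show ?thesis by blast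
qed

text \<open>A single radius \<open>k\<close> is used: a window of length \<open>2 * k + 1\<close>
  both holds every forbidden word of \<open>Y\<close> and determines one coordinate of the
  image.\<close>

locale windowed_factor =
  fixes B :: "'b set" and Y :: "(int \<Rightarrow> 'b) set" and A :: "'a set" and X :: "(int \<Rightarrow> 'a) set"
    and \<pi> :: "(int \<Rightarrow> 'b) \<Rightarrow> int \<Rightarrow> 'a" and k :: nat and F :: "'b list set"
  assumes Y: "two_sided_shift B Y" and X: "two_sided_shift A X"
    and factor: "factor_map B Y A X \<pi>" and irreducible: "irreducible_shift Y"
    and Y_eq: "Y = {y. range y \<subseteq> B \<and> (\<forall>w\<in>F. \<not> occurs_in w y)}"
    and F: "\<And>w. w \<in> F \<Longrightarrow> length w \<le> 2 * k + 1"
    and window: "\<And>y z. y \<in> Y \<Longrightarrow> z \<in> Y \<Longrightarrow> (\<And>j. \<bar>j\<bar> \<le> int k \<Longrightarrow> y j = z j) \<Longrightarrow> \<pi> y 0 = \<pi> z 0"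
begin

abbreviation K :: nat where "K \<equiv> 2 * k + 1"

text \<open>
  The window at \<open>i\<close> starts, rather than is centred, at \<open>i\<close>. So labels are shifted by \<open>k\<close>.
\<close>

definition window_edges :: "('b list, 'a) edges" where
  "window_edges = {(block y 0 K, \<pi> y (int k), block y 1 K) |y. y \<in> Y}"

lemma translate: "y \<in> Y \<Longrightarrow> (\<lambda>i. y (i + n)) \<in> Y"
  using translate_closed Y by (auto simp: two_sided_shift_def)

lemma map_translate: "y \<in> Y \<Longrightarrow> \<pi> (\<lambda>i. y (i + n)) = (\<lambda>i. \<pi> y (i + n))"
  using factor_map_translate[OF factor] Y by (auto simp: two_sided_shift_def)

lemma block_translate: "block (\<lambda>i. y (i + n)) i m = block y (i + n) m" for n :: int
  by (simp add: block_def ac_simps)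

lemma window_edge:
  assumes "y \<in> Y"
  shows "(block y i K, \<pi> y (i + int k), block y (i + 1) K) \<in> window_edges"
proof -
  let ?y = "\<lambda>j. y (j + i)"
  have "(block ?y 0 K, \<pi> ?y (int k), block ?y 1 K) \<in> window_edges"
    using translate[OF assms] unfolding window_edges_def by blast
  then show ?thesis
    unfolding block_translate map_translate[OF assms] by (simp add: ac_simps)
qed

lemma map_eq_if_block_eq:
  assumes "y \<in> Y" "z \<in> Y" "block y i K = block z i' K"
  shows "\<pi> y (i + int k) = \<pi> z (i' + int k)"
proof -
  have "y (j + (i + int k)) = z (j + (i' + int k))" if "\<bar>j\<bar> \<le> int k" for j
  proof -
    have n: "nat (j + int k) < K" and j: "0 \<le> j + int k" using that by linarith+
    have "block y i K ! nat (j + int k) = block z i' K ! nat (j + int k)"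
      using assms(3) by simp
    then have "y (i + (j + int k)) = z (i' + (j + int k))"
      unfolding nth_block[OF n] using j by simp
    then show ?thesis by (simp add: ac_simps)
  qed
  then have "\<pi> (\<lambda>j. y (j + (i + int k))) 0 = \<pi> (\<lambda>j. z (j + (i' + int k))) 0"
    using translate assms by (intro window) auto
  then show ?thesis using map_translate assms by simp
qed

lemma run_window_edges:
  assumes "y \<in> Y"
  shows "run window_edges (block (\<pi> y) (i + int k) n) (\<lambda>m. block y (i + int m) K)"
  unfolding run_def
proof (intro allI impI)
  fix m assume "m < length (block (\<pi> y) (i + int k) n)"
  then have "block (\<pi> y) (i + int k) n ! m = \<pi> y (i + int m + int k)" by (simp add: ac_simps)
  then show "(block y (i + int m) K, block (\<pi> y) (i + int k) n ! m, block y (i + int (Suc m)) K)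
      \<in> window_edges"
    using window_edge[OF assms, of "i + int m"] by (simp add: ac_simps)
qed

lemma finite_window_edges: "finite window_edges"
proof -
  have "window_edges \<subseteq> {w. set w \<subseteq> B \<and> length w = K} \<times> A \<times> {w. set w \<subseteq> B \<and> length w = K}"
  proof -
    have "set (block y i K) \<subseteq> B" "\<pi> y j \<in> A" if "y \<in> Y" for y i j
    proof -
      have "range y \<subseteq> B" using two_sided_shift_range[OF Y that] .
      then show "set (block y i K) \<subseteq> B" by (auto simp: block_def)
      have "\<pi> y \<in> X" using factor that by (auto simp: factor_map_def)
      from two_sided_shift_range[OF X this] show "\<pi> y j \<in> A" by blast
    qed
    then show ?thesis by (auto simp: window_edges_def)
  qed
  then show ?thesis
    by (rule finite_subset)
      (use X Y in \<open>auto simp: two_sided_shift_def intro: finite_lists_length_eq\<close>)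
qed

lemma states_window_edges: "states window_edges = {block y 0 K |y. y \<in> Y}"
proof (intro subset_antisym subsetI)
  fix s assume "s \<in> states window_edges"
  then obtain y where "y \<in> Y" "s = block y 0 K \<or> s = block y 1 K"
    unfolding states_def window_edges_def by blast
  then show "s \<in> {block y 0 K |y. y \<in> Y}"
    using translate[of y 1] block_translate[of y 1 0 K] by (auto; metis)
next
  fix s assume "s \<in> {block y 0 K |y. y \<in> Y}"
  then obtain y where "y \<in> Y" "s = block y 0 K" by blast
  then show "s \<in> states window_edges" using window_edge[of y 0] unfolding states_def by auto
qed

lemma strongly_connected_window_edges: "strongly_connected_edges window_edges"
  unfolding strongly_connected_edges_def
proof (intro ballI)
  fix s t assume "s \<in> states window_edges" "t \<in> states window_edges"
  then obtain y z where yz: "y \<in> Y" "s = block y 0 K" "z \<in> Y" "t = block z 0 K"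
    unfolding states_window_edges by blast
  then have "s \<in> language Y" "t \<in> language Y" by (auto simp: language_def)
  then obtain v where "s @ v @ t \<in> language Y"
    using irreducible unfolding irreducible_shift_def by blast
  then obtain y' i where y': "y' \<in> Y" "s @ v @ t = block y' i (K + (length v + K))"
    using yz by (auto simp: language_def occurs_in_iff_block)
  then have "s @ v @ t = block y' i K @ block y' (i + int K) (length v)
      @ block y' (i + int K + int (length v)) K"
    by (simp only: block_add of_nat_id)
  then have s: "s = block y' i K" and t: "t = block y' (i + int K + int (length v)) K"
    using yz by auto
  \<comment> \<open>The windows \<open>s\<close> and \<open>t\<close> start
    \<open>K + length v\<close> positions apart in \<open>y'\<close>, which is the number of
    steps.\<close>
  show "\<exists>w. connects window_edges s w t"
    unfolding connects_def
    using run_window_edges[OF y'(1), of i "K + length v"] s t by (force simp: ac_simps)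
qed

text \<open>Consecutive windows overlap in all but one letter, so their first letters form a
  sequence \<open>y\<close> with exactly these windows. Each forbidden word fits into a window, and
  each window comes from a point of \<open>Y\<close>, hence \<open>y \<in> Y\<close>.\<close>

lemma birun_window_edges:
  assumes "birun window_edges x r"
  shows "\<exists>y\<in>Y. (\<forall>i. r i = block y i K) \<and> x = (\<lambda>i. \<pi> y (i + int k))"
proof -
  have "\<forall>i. \<exists>z\<in>Y. r i = block z 0 K \<and> x i = \<pi> z (int k) \<and> r (i + 1) = block z 1 K"
  proof
    fix i
    have "(r i, x i, r (i + 1)) \<in> window_edges" using assms by (simp add: birun_def)
    then show "\<exists>z\<in>Y. r i = block z 0 K \<and> x i = \<pi> z (int k) \<and> r (i + 1) = block z 1 K"
      unfolding window_edges_def by blast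
  qed
  then obtain z where z: "\<And>i. z i \<in> Y" "\<And>i. r i = block (z i) 0 K"
    "\<And>i. x i = \<pi> (z i) (int k)" "\<And>i. r (i + 1) = block (z i) 1 K" by metis
  define y where "y i = r i ! 0" for i
  have nth: "r i ! m = y (i + int m)" if "m < K" for i m
    using that
  proof (induction m arbitrary: i)
    case 0 then show ?case by (simp add: y_def)
  next
    case (Suc m)
    have "r i ! Suc m = r (i + 1) ! m"
      unfolding z(4) using Suc.prems z(2)[of i] by (simp add: ac_simps)
    then show ?case using Suc by (simp add: ac_simps)
  qed
  have r: "r i = block y i K" for i
    by (rule nth_equalityI) (use nth z(2) in auto)
  have "y \<in> Y"
  proof -
    have "y i \<in> B" for i
      using two_sided_shift_range[OF Y z(1)[of i]] z(2)[of i] by (auto simp: y_def)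
    moreover have "\<not> occurs_in w y" if "w \<in> F" for w
    proof
      assume "occurs_in w y"
      then obtain i where i: "w = block y i (length w)" by (auto simp: occurs_in_iff_block)
      have "K = length w + (K - length w)" using F[OF that] by simp
      then have "take (length w) (block y i K) = w" "take (length w) (block (z i) 0 K)
          = block (z i) 0 (length w)"
        using i block_add[of y i "length w" "K - length w"]
          block_add[of "z i" 0 "length w" "K - length w"] by auto
      then have "w = block (z i) 0 (length w)" using r[of i] z(2)[of i] by simp
      then have "occurs_in w (z i)" by (auto simp: occurs_in_iff_block)
      then show False using z(1)[of i] that by (auto simp: Y_eq)
    qed
    ultimately show ?thesis by (auto simp: Y_eq)
  qed
  moreover have "x i = \<pi> y (i + int k)" for i
    using map_eq_if_block_eq[OF z(1)[of i] \<open>y \<in> Y\<close>, of 0 i] z(2,3)[of i] r[of i] by simp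
  ultimately show ?thesis using r by (intro bexI[of _ y]) auto
qed

text \<open>For the inclusion of \<open>run_words\<close> in the language, a finite run is prolonged
  in both directions by strong connectedness; the bi-infinite run then belongs to a point of
  \<open>Y\<close>.\<close>

lemma language_window_edges:
  assumes "X \<noteq> {}"
  shows "language X = run_words window_edges"
proof (intro subset_antisym subsetI)
  fix w assume "w \<in> language X"
  then obtain y i where "y \<in> Y" "w = block (\<pi> y) i (length w)"
    using factor by (auto simp: language_def occurs_in_iff_block factor_map_def)
  then have "run window_edges w (\<lambda>m. block y (i - int k + int m) K)"
    using run_window_edges[of y "i - int k" "length w"] by simp
  then show "w \<in> run_words window_edges" by (auto simp: run_words_def)
next
  fix w assume "w \<in> run_words window_edges"
  then obtain r where r: "run window_edges w r" by (auto simp: run_words_def)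
  show "w \<in> language X"
  proof (cases "w = []")
    case True then show ?thesis using assms by (auto simp: language_def occurs_in_def)
  next
    case False
    then have st: "r (length w) \<in> states window_edges" "r 0 \<in> states window_edges"
      using run_state[OF r] by auto
    obtain x s where s: "rrun window_edges x s" "s 0 = r (length w)"
      using strongly_connected_rrun[OF strongly_connected_window_edges st(1)] by blast
    obtain x' l where l: "rrun (converse_edges window_edges) x' l" "l 0 = r 0"
      using strongly_connected_rrun[OF
          strongly_connected_converse_edges[OF strongly_connected_window_edges], of "r 0"] st(2)
      by auto
    let ?z = "\<lambda>n. if n < length w then w ! n else x (n - length w)"
    let ?t = "\<lambda>n. if n < length w then r n else s (n - length w)"
    have "rrun window_edges ?z ?t" using rrun_append[OF r s(1)] s(2) by simp
    moreover have "l 0 = ?t 0" using l(2) False by simp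
    ultimately obtain q where q: "birun window_edges
        (\<lambda>i. if 0 \<le> i then ?z (nat i) else x' (nat (- i - 1))) q"
      using birun_glue[OF l(1)] by blast
    obtain y where y: "y \<in> Y"
      "(\<lambda>i. if 0 \<le> i then ?z (nat i) else x' (nat (- i - 1))) = (\<lambda>i. \<pi> y (i + int k))"
      using birun_window_edges[OF q] by blast
    have "w ! n = \<pi> y (int k + int n)" if "n < length w" for n
      using fun_cong[OF y(2), of "int n"] that by (simp add: ac_simps)
    then have "occurs_in w (\<pi> y)" unfolding occurs_in_def by (intro exI[of _ "int k"]) simp
    moreover have "\<pi> y \<in> X" using factor y(1) by (auto simp: factor_map_def)
    ultimately show ?thesis by (auto simp: language_def)
  qed
qed

text \<open>The chosen state is the window of \<open>y\<close> centred at \<open>0\<close>.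
  Bi-infinite runs through it with one label come from points of \<open>Y\<close> that, once
  recentred, lie in the cylinder of \<open>y\<close> and have the same image.\<close>

lemma biclosing_window_edges:
  assumes y: "y \<in> Y" and inj: "inj_on \<pi> {z \<in> Y. \<forall>j. \<bar>j\<bar> \<le> int k \<longrightarrow> z j = y j}"
  shows "\<exists>D. biclosing window_edges D"
proof (rule biclosing_if_unique_biruns)
  show "block y (- int k) K \<in> states window_edges"
    unfolding states_window_edges
    using translate[OF y, of "- int k"] block_translate[of y "- int k" 0 K] by force
  fix x r s
  assume *: "birun window_edges x r" "birun window_edges x s"
    "r 0 = block y (- int k) K" "s 0 = block y (- int k) K"
  obtain p where p: "p \<in> Y" "\<And>i. r i = block p i K" "x = (\<lambda>i. \<pi> p (i + int k))"
    using birun_window_edges[OF *(1)] by blast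
  obtain q where q: "q \<in> Y" "\<And>i. s i = block q i K" "x = (\<lambda>i. \<pi> q (i + int k))"
    using birun_window_edges[OF *(2)] by blast
  have near: "z (j + int k) = y j" if "block z 0 K = block y (- int k) K" "\<bar>j\<bar> \<le> int k" for z j
  proof -
    have n: "nat (j + int k) < K" and j: "0 \<le> j + int k" using that(2) by linarith+
    have "block z 0 K ! nat (j + int k) = block y (- int k) K ! nat (j + int k)"
      using that(1) by simp
    then show ?thesis unfolding nth_block[OF n] using j by simp
  qed
  have "(\<lambda>i. p (i + int k)) = (\<lambda>i. q (i + int k))"
  proof (rule inj_onD[OF inj])
    show "\<pi> (\<lambda>i. p (i + int k)) = \<pi> (\<lambda>i. q (i + int k))"
      using map_translate p(1,3) q(1,3) by simp
    have "p (j + int k) = y j" "q (j + int k) = y j" if "\<bar>j\<bar> \<le> int k" for j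
      using near[OF _ that] p(2) q(2) *(3,4) by metis+
    then show "(\<lambda>i. p (i + int k)) \<in> {z \<in> Y. \<forall>j. \<bar>j\<bar> \<le> int k \<longrightarrow> z j = y j}"
      "(\<lambda>i. q (i + int k)) \<in> {z \<in> Y. \<forall>j. \<bar>j\<bar> \<le> int k \<longrightarrow> z j = y j}"
      using translate p(1) q(1) by auto
  qed
  then have "p (i - int k + int k) = q (i - int k + int k)" for i by metis
  then have "p = q" by auto
  then show "r = s" using p(2) q(2) by auto
qed (use finite_window_edges strongly_connected_window_edges in auto)

end

lemma two_sided_AFT_biclosing:
  fixes X :: "(int \<Rightarrow> 'a) set"
  assumes X: "two_sided_shift A X" and "two_sided_AFT A X" and "X \<noteq> {}"
  shows "\<exists>(E :: (nat list, 'a) edges) D. biclosing E D \<and> language X = run_words E"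
proof -
  obtain B :: "nat set" and Y \<pi> U where Y: "two_sided_shift B Y" "finite_type B Y"
    "irreducible_shift Y" and \<pi>: "factor_map B Y A X \<pi>"
    and U: "openin (subtopology (full_shift_topology B) Y) U" "U \<noteq> {}" "inj_on \<pi> U"
    using assms(2) unfolding two_sided_AFT_def by blast
  obtain F where F: "finite F" "Y = {y. range y \<subseteq> B \<and> (\<forall>w\<in>F. \<not> occurs_in w y)}"
    using Y(2) unfolding finite_type_def by blast
  obtain S where S: "openin (full_shift_topology B) S" "U = S \<inter> Y"
    using U(1) unfolding openin_subtopology by blast
  obtain y where y: "y \<in> S" "y \<in> Y" using U(2) S(2) by blast
  obtain J where J: "finite J" "\<forall>z. range z \<subseteq> B \<and> (\<forall>j\<in>J. z j = y j) \<longrightarrow> z \<in> S"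
    using openin_full_shift_cylinder[OF S(1) y(1)] by blast
  obtain J' where J': "finite J'"
    "\<forall>y\<in>Y. \<forall>z\<in>Y. (\<forall>j\<in>J'. y j = z j) \<longrightarrow> \<pi> y 0 = \<pi> z 0"
    using Curtis_Hedlund_Lyndon[OF \<pi> Y(1)] two_sided_shift_range[OF X] by blast
  obtain n where n: "\<forall>j\<in>J \<union> J'. \<bar>j\<bar> \<le> int n"
    using finite_int_set_bounded[of "J \<union> J'"] J(1) J'(1) by auto
  obtain N where N: "\<And>w. w \<in> F \<Longrightarrow> length w \<le> N"
    using F(1) by (metis Max_ge finite_imageI imageI)
  \<comment> \<open>\<open>n\<close> covers the cylinder inside \<open>U\<close> and the window of
    the local rule, \<open>N\<close> the lengths of the forbidden words.\<close>
  define k where "k = n + N"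
  interpret windowed_factor B Y A X \<pi> k F
  proof
    show "length w \<le> 2 * k + 1" if "w \<in> F" for w using N[OF that] by (simp add: k_def)
    show "\<pi> y 0 = \<pi> z 0"
      if "y \<in> Y" "z \<in> Y" "\<And>j. \<bar>j\<bar> \<le> int k \<Longrightarrow> y j = z j" for y z
    proof -
      have "\<forall>j\<in>J'. y j = z j" using that(3) n by (force simp: k_def)
      then show ?thesis using J'(2) that by blast
    qed
  qed (use X Y \<pi> F in auto)
  have "{z \<in> Y. \<forall>j. \<bar>j\<bar> \<le> int k \<longrightarrow> z j = y j} \<subseteq> U"
  proof
    fix z assume z: "z \<in> {z \<in> Y. \<forall>j. \<bar>j\<bar> \<le> int k \<longrightarrow> z j = y j}"
    then have "\<forall>j\<in>J. z j = y j" using n by (force simp: k_def)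
    then show "z \<in> U" using J(2) S(2) z two_sided_shift_range[OF Y(1)] by blast
  qed
  then have "inj_on \<pi> {z \<in> Y. \<forall>j. \<bar>j\<bar> \<le> int k \<longrightarrow> z j = y j}"
    using U(3) inj_on_subset by blast
  then show ?thesis
    using biclosing_window_edges[OF y(2)] language_window_edges[OF assms(3)] by blast
qed

theorem theorem5p8:
  fixes A :: "'a set"
  shows "(\<forall>X :: (int \<Rightarrow> 'a) set.
            two_sided_shift A X \<and> irreducible_shift X \<and> two_sided_strictly_sofic A X \<and>
            two_sided_AFT A X \<longrightarrow> reducible_graph (past_set_cover X)) \<and>
         (\<forall>X :: (nat \<Rightarrow> 'a) set.
            one_sided_shift A X \<and> irreducible_shift X \<and> one_sided_strictly_sofic A X \<and>
            one_sided_AFT X \<longrightarrow> reducible_graph (past_set_cover X))"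
proof (intro conjI allI impI; elim conjE; rule ccontr)
  fix X :: "(int \<Rightarrow> 'a) set"
  assume X: "two_sided_shift A X" "two_sided_strictly_sofic A X" "two_sided_AFT A X"
    and irr: "\<not> reducible_graph (past_set_cover X)"
  have not_ft: "\<not> finite_type A X" using X(2) by (simp add: two_sided_strictly_sofic_def)
  then have "X \<noteq> {}" using finite_type_empty by blast
  then obtain E :: "(nat list, 'a) edges" and D where "biclosing E D" "language X = run_words E"
    using two_sided_AFT_biclosing X by blast
  then have "finite_type A X"
    using X(1) two_sided_shift_range[OF X(1)] two_sided_shiftI_language[OF X(1)] irr
    by (intro biclosing_imp_finite_type) (auto simp: two_sided_shift_def)
  then show False using not_ft by blast
next
  fix X :: "(nat \<Rightarrow> 'a) set"
  assume X: "one_sided_shift A X" "irreducible_shift X" "one_sided_strictly_sofic A X"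
    "one_sided_AFT X" and irr: "\<not> reducible_graph (past_set_cover X)"
  have not_ft: "\<not> finite_type A X" using X(3) by (simp add: one_sided_strictly_sofic_def)
  then have "X \<noteq> {}" using finite_type_empty by blast
  then obtain E :: "(nat, 'a) edges" and D where "biclosing E D" "language X = run_words E"
    using one_sided_AFT_biclosing X by blast
  then have "finite_type A X"
    using one_sided_shift_closed[OF X(1)] one_sided_shift_range[OF X(1)]
      one_sided_shiftI_language[OF X(1)] irr
    by (intro biclosing_imp_finite_type) auto
  then show False using not_ft by blast
qed

end
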